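(* Let $X$ be a compact Hermitian manifold. For any Brody curve $f\in\mathcal{M}(X)$, with $\overline{\mathbb{C}\cdot f}\subset \mathcal{M}(X)$ denoting the closure of the $\mathbb{C}$-orbit of $f$, we have \[ \rho(f)=\rho(\overline{\mathbb{C}\cdot f})=\rho_{\mathrm{NSA}}(\overline{\mathbb{C}\cdot f})=\underline{\rho}_{\mathrm{NSA}}(\overline{\mathbb{C}\cdot f}). \] Hence for any $\mathbb{C}$-invariant closed subset $\mathcal{N}\subset\mathcal{M}(X)$, \[ \rho(\mathcal{N})=\rho_{\mathrm{NSA}}(\mathcal{N})=\underline{\rho}_{\mathrm{NSA}}(\mathcal{N}). \]
   Context: Let $z=x+y\sqrt{-1}$ be the standard coordinate of $\mathbb{C}$. Let $X$ be a compact Hermitian manifold with Kähler form $\omega$ (the positive $(1,1)$-form associated with the Hermitian metric; it is not assumed closed). For a holomorphic map $f:\mathbb{C}\to X$ the spherical derivative $|df|(z)\ge 0$ is defined by $f^*\omega=|df|^2\,dx\,dy$. The map $f$ is called a Brody curve if $|df|(z)\le 1$ for all $z\in\mathbb{C}$. $\mathcal{M}(X)$ is the space of all Brody curves in $X$, with the compact-open topology; it carries the continuous $\mathbb{C}$-action $\mathbb{C}\times\mathcal{M}(X)\to\mathcal{M}(X)$, $(a,f(z))\mapsto f(z+a)$. Orbits, invariance and closures are with respect to this action and this topology. For $f\in\mathcal{M}(X)$ the energy density is \[ \rho(f):=\lim_{R\to\infty}\left(\frac{1}{\pi R^2}\sup_{a\in\mathbb{C}}\int_{|z-a|<R}|df|^2\,dx\,dy\right)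 \] (this limit always exists). The Nevanlinna-Shimizu-Ahlfors characteristic function is \[ T(r,f):=\int_1^r\left(\int_{|z|<t}|df|^2\,dx\,dy\right)\frac{dt}{t}\qquad (r\ge 1), \] and \[ \rho_{\mathrm{NSA}}(f):=\limsup_{r\to\infty}\frac{2}{\pi r^2}T(r,f),\qquad \underline{\rho}_{\mathrm{NSA}}(f):=\liminf_{r\to\infty}\frac{2}{\pi r^2}T(r,f). \] For a $\mathbb{C}$-invariant closed subset $\mathcal{N}\subset\mathcal{M}(X)$, the quantities $\rho(\mathcal{N})$, $\rho_{\mathrm{NSA}}(\mathcal{N})$, $\underline{\rho}_{\mathrm{NSA}}(\mathcal{N})$ are the suprema over $f\in\mathcal{N}$ of $\rho(f)$, $\rho_{\mathrm{NSA}}(f)$, $\underline{\rho}_{\mathrm{NSA}}(f)$ respectively. *)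

theory Defs
  imports "HOL-Analysis.Analysis"
begin

section \<open>Holomorphic and smooth maps between open sets of coordinate spaces\<close>

definition holomorphic_map_on ::
    "(complex^'n \<Rightarrow> complex^'m) \<Rightarrow> (complex^'n) set \<Rightarrow> bool" where
  "holomorphic_map_on F S \<longleftrightarrow>
     (\<forall>p\<in>S. \<exists>D. (F has_derivative D) (at p) \<and> (\<forall>c v. D (c *s v) = c *s D v))"

text \<open>Class \<open>C\<^sup>k\<close> in the real sense, on an open set.\<close>

primrec Ck_on ::
    "nat \<Rightarrow> 'a::euclidean_space set \<Rightarrow> ('a \<Rightarrow> 'b::real_normed_vector) \<Rightarrow> bool" where
  "Ck_on 0 S F \<longleftrightarrow> continuous_on S F"
| "Ck_on (Suc k) S F \<longleftrightarrow>
     F differentiable_on S \<and> (\<forall>v. Ck_on k S (\<lambda>p. frechet_derivative F (at p) v))"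

definition smooth_map_on ::
    "('a::euclidean_space \<Rightarrow> 'b::real_normed_vector) \<Rightarrow> 'a set \<Rightarrow> bool" where
  "smooth_map_on F S \<longleftrightarrow> (\<forall>k. Ck_on k S F)"


section \<open>Compact Hermitian manifolds\<close>

text \<open>A chart is its domain together with a coordinate map, which is only meaningful there.\<close>

type_synonym ('a, 'n) chart = "'a set \<times> ('a \<Rightarrow> complex^'n)"

definition transition ::
    "('a, 'n) chart \<Rightarrow> ('a, 'n) chart \<Rightarrow> complex^'n \<Rightarrow> complex^'n" where
  "transition c c' = (\<lambda>p. snd c' (inv_into (fst c) (snd c) p))"

definition complex_atlas :: "'a topology \<Rightarrow> ('a, 'n::finite) chart set \<Rightarrow> bool" where
  "complex_atlas X A \<longleftrightarrow>
     (\<forall>c\<in>A. openin X (fst c) \<and> open (snd c ` fst c) \<and>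
        homeomorphic_map (subtopology X (fst c)) (top_of_set (snd c ` fst c)) (snd c)) \<and>
     (\<Union>c\<in>A. fst c) = topspace X \<and>
     (\<forall>c\<in>A. \<forall>c'\<in>A. holomorphic_map_on (transition c c') (snd c ` (fst c \<inter> fst c')))"

definition hermitian_form :: "complex^'n^'n \<Rightarrow> complex^'n \<Rightarrow> complex^'n \<Rightarrow> complex" where
  "hermitian_form H u v = (\<Sum>j\<in>UNIV. \<Sum>k\<in>UNIV. H $ j $ k * u $ j * cnj (v $ k))"

text \<open>
  A Hermitian metric is given by its coefficient matrices: \<open>h c x\<close> is the matrix at the
  point \<open>x\<close> with respect to the chart \<open>c\<close>.  The last condition says that the local
  expressions agree on overlaps, the differential of the transition map identifying
  the coordinate representations of a tangent vector.
\<close>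

definition hermitian_metric ::
    "('a, 'n::finite) chart set \<Rightarrow> (('a, 'n) chart \<Rightarrow> 'a \<Rightarrow> complex^'n^'n) \<Rightarrow> bool" where
  "hermitian_metric A h \<longleftrightarrow>
     (\<forall>c\<in>A. \<forall>x\<in>fst c.
        (\<forall>j k. h c x $ k $ j = cnj (h c x $ j $ k)) \<and>
        (\<forall>u. u \<noteq> 0 \<longrightarrow> 0 < Re (hermitian_form (h c x) u u))) \<and>
     (\<forall>c\<in>A. smooth_map_on (\<lambda>p. h c (inv_into (fst c) (snd c) p)) (snd c ` fst c)) \<and>
     (\<forall>c\<in>A. \<forall>c'\<in>A. \<forall>x\<in>fst c \<inter> fst c'. \<forall>u v.
        hermitian_form (h c x) u v =
        hermitian_form (h c' x)
          (frechet_derivative (transition c c') (at (snd c x)) u)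
          (frechet_derivative (transition c c') (at (snd c x)) v))"

locale compact_hermitian_manifold =
  fixes X :: "'a topology"
    and A :: "('a, 'n::finite) chart set"
    and h :: "('a, 'n) chart \<Rightarrow> 'a \<Rightarrow> complex^'n^'n"
  assumes compact_space: "compact_space X"
    and Hausdorff_space: "Hausdorff_space X"
    and complex_atlas: "complex_atlas X A"
    and hermitian_metric: "hermitian_metric A h"

text \<open>
  The value at two tangent vectors of the form
  \<open>\<omega> = (\<i>/2) \<Sum>\<^sub>j\<^sub>k H\<^sub>j\<^sub>k dz\<^sub>j \<and> d(cnj z\<^sub>k)\<close>.
\<close>

definition kaehler_form :: "complex^'n^'n \<Rightarrow> complex^'n \<Rightarrow> complex^'n \<Rightarrow> real" where
  "kaehler_form H u v = - Im (hermitian_form H u v)"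


section \<open>Brody curves\<close>

definition holomorphic_curve ::
    "'a topology \<Rightarrow> ('a, 'n::finite) chart set \<Rightarrow> (complex \<Rightarrow> 'a) \<Rightarrow> bool" where
  "holomorphic_curve X A f \<longleftrightarrow>
     continuous_map euclidean X f \<and>
     (\<forall>c\<in>A. \<forall>i. (\<lambda>z. snd c (f z) $ i) holomorphic_on {z. f z \<in> fst c})"

text \<open>
  The coefficient of \<open>dx dy\<close> in the pullback of the Kaehler form at \<open>z\<close>, that is, its value at
  \<open>(\<partial>/\<partial>x, \<partial>/\<partial>y)\<close>.  It does not depend on the chart around \<open>f z\<close>.
\<close>

definition pullback_density ::
    "('a, 'n::finite) chart set \<Rightarrow> (('a, 'n) chart \<Rightarrow> 'a \<Rightarrow> complex^'n^'n) \<Rightarrow>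
     (complex \<Rightarrow> 'a) \<Rightarrow> complex \<Rightarrow> real" where
  "pullback_density A h f z =
     (let c = (SOME c. c \<in> A \<and> f z \<in> fst c);
          D = frechet_derivative (\<lambda>w. snd c (f w)) (at z)
      in kaehler_form (h c (f z)) (D 1) (D \<i>))"

definition spherical_derivative ::
    "('a, 'n::finite) chart set \<Rightarrow> (('a, 'n) chart \<Rightarrow> 'a \<Rightarrow> complex^'n^'n) \<Rightarrow>
     (complex \<Rightarrow> 'a) \<Rightarrow> complex \<Rightarrow> real" where
  "spherical_derivative A h f z = sqrt (pullback_density A h f z)"

definition brody_curves ::
    "'a topology \<Rightarrow> ('a, 'n::finite) chart set \<Rightarrow>
     (('a, 'n) chart \<Rightarrow> 'a \<Rightarrow> complex^'n^'n) \<Rightarrow> (complex \<Rightarrow> 'a) set" where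
  "brody_curves X A h =
     {f. holomorphic_curve X A f \<and> (\<forall>z. spherical_derivative A h f z \<le> 1)}"

definition compact_open_topology ::
    "'a topology \<Rightarrow> ('b::topological_space \<Rightarrow> 'a) topology" where
  "compact_open_topology X =
     topology_generated_by
       {{f. continuous_map euclidean X f \<and> f ` K \<subseteq> U} | K U. compact K \<and> openin X U}"

definition brody_space ::
    "'a topology \<Rightarrow> ('a, 'n::finite) chart set \<Rightarrow>
     (('a, 'n) chart \<Rightarrow> 'a \<Rightarrow> complex^'n^'n) \<Rightarrow> (complex \<Rightarrow> 'a) topology" where
  "brody_space X A h = subtopology (compact_open_topology X) (brody_curves X A h)"

definition translate :: "complex \<Rightarrow> (complex \<Rightarrow> 'a) \<Rightarrow> complex \<Rightarrow> 'a" where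
  "translate a f = (\<lambda>z. f (z + a))"

definition orbit_closure ::
    "'a topology \<Rightarrow> ('a, 'n::finite) chart set \<Rightarrow>
     (('a, 'n) chart \<Rightarrow> 'a \<Rightarrow> complex^'n^'n) \<Rightarrow> (complex \<Rightarrow> 'a) \<Rightarrow> (complex \<Rightarrow> 'a) set" where
  "orbit_closure X A h f = brody_space X A h closure_of (range (\<lambda>a. translate a f))"

definition translation_invariant :: "(complex \<Rightarrow> 'a) set \<Rightarrow> bool" where
  "translation_invariant N \<longleftrightarrow> (\<forall>a. \<forall>f\<in>N. translate a f \<in> N)"


section \<open>Energy density and the characteristic function\<close>

text \<open>
  All quantities are nonnegative and are taken in \<^typ>\<open>ennreal\<close>, where suprema, upper and
  lower limits are unconditionally defined.
\<close>

definition energy ::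
    "('a, 'n::finite) chart set \<Rightarrow> (('a, 'n) chart \<Rightarrow> 'a \<Rightarrow> complex^'n^'n) \<Rightarrow>
     (complex \<Rightarrow> 'a) \<Rightarrow> complex \<Rightarrow> real \<Rightarrow> ennreal" where
  "energy A h f a R = (\<integral>\<^sup>+z\<in>ball a R. ennreal ((spherical_derivative A h f z)\<^sup>2) \<partial>lborel)"

definition energy_density ::
    "('a, 'n::finite) chart set \<Rightarrow> (('a, 'n) chart \<Rightarrow> 'a \<Rightarrow> complex^'n^'n) \<Rightarrow>
     (complex \<Rightarrow> 'a) \<Rightarrow> ennreal" where
  "energy_density A h f =
     Lim at_top (\<lambda>R. ennreal (1 / (pi * R\<^sup>2)) * (SUP a. energy A h f a R))"

definition NSA_characteristic ::
    "('a, 'n::finite) chart set \<Rightarrow> (('a, 'n) chart \<Rightarrow> 'a \<Rightarrow> complex^'n^'n) \<Rightarrow>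
     real \<Rightarrow> (complex \<Rightarrow> 'a) \<Rightarrow> ennreal" where
  "NSA_characteristic A h r f = (\<integral>\<^sup>+t\<in>{1..r}. (energy A h f 0 t * ennreal (1 / t)) \<partial>lborel)"

definition upper_NSA_density ::
    "('a, 'n::finite) chart set \<Rightarrow> (('a, 'n) chart \<Rightarrow> 'a \<Rightarrow> complex^'n^'n) \<Rightarrow>
     (complex \<Rightarrow> 'a) \<Rightarrow> ennreal" where
  "upper_NSA_density A h f =
     Limsup at_top (\<lambda>r. ennreal (2 / (pi * r\<^sup>2)) * NSA_characteristic A h r f)"

definition lower_NSA_density ::
    "('a, 'n::finite) chart set \<Rightarrow> (('a, 'n) chart \<Rightarrow> 'a \<Rightarrow> complex^'n^'n) \<Rightarrow>
     (complex \<Rightarrow> 'a) \<Rightarrow> ennreal" where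
  "lower_NSA_density A h f =
     Liminf at_top (\<lambda>r. ennreal (2 / (pi * r\<^sup>2)) * NSA_characteristic A h r f)"

end

theory Submission
  imports Defs "HOL-Complex_Analysis.Cauchy_Integral_Formula"
begin

text \<open>
  Write \<open>u = |df|\<^sup>2\<close>, a continuous function with values in \<open>[0, 1]\<close>, and let \<open>M(s)\<close> be the supremum
  of its mean values over discs of radius \<open>s\<close>.  Averaging \<open>u\<close> at scale \<open>s\<close> first costs only a
  boundary term, so \<open>M(r) \<le> M(s) (1 + s/r)\<^sup>2\<close>; hence \<open>M(r)\<close> converges to \<open>\<rho> = inf M\<close>.

  The key point is that for every \<open>\<epsilon> > 0\<close> there is a radius \<open>r\<^sub>0\<close> such that for all \<open>R\<close> some centre
  \<open>a\<close> has mean value at least \<open>\<rho> - \<epsilon>\<close> on every disc about \<open>a\<close> with radius in \<open>[r\<^sub>0, R]\<close>.  Otherwise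
  every point is the centre of a bad disc of bounded radius; by Vitali's lemma disjoint bad discs
  fill a fixed proportion of any large disc, while the \<open>s\<close>-averages of \<open>u\<close> are at most
  \<open>M(s) \<approx> \<rho>\<close> on the rest, so that the mean value on large discs would stay below \<open>\<rho>\<close>.

  The space of Brody curves is compact, because Brody curves are equicontinuous and thus carry the
  topology of pointwise convergence, to which Tychonoff's theorem applies.  A cluster point of the
  translates of \<open>f\<close> to these centres, as \<open>R \<rightarrow> \<infinity>\<close>, lies in every closed set containing the orbit
  and has mean value at least \<open>\<rho> - \<epsilon>\<close> on all discs about \<open>0\<close> of radius at least \<open>r\<^sub>0\<close>, which bounds its
  lower Nevanlinna-Shimizu-Ahlfors density from below.
\<close>

section \<open>Mean values over discs in the plane\<close>

definition disc_integral :: "(complex \<Rightarrow> real) \<Rightarrow> complex \<Rightarrow> real \<Rightarrow> real" where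
  "disc_integral u a r = (LINT z:ball a r|lborel. u z)"

definition mean_sup :: "(complex \<Rightarrow> real) \<Rightarrow> real \<Rightarrow> real" where
  "mean_sup u r = (SUP a. disc_integral u a r) / (pi * r\<^sup>2)"

text \<open>As an infimum it bounds \<open>mean_sup u r\<close> from below at every single radius,
  as the covering argument requires on large discs. By \<open>tendsto_mean_sup\<close> it is also
  the limit of the mean values.\<close>

definition disc_density :: "(complex \<Rightarrow> real) \<Rightarrow> real" where
  "disc_density u = (INF r\<in>{0<..}. mean_sup u r)"

lemma emeasure_disc: "r \<ge> 0 \<Longrightarrow> emeasure lborel (ball (a::complex) r) = ennreal (pi * r\<^sup>2)"
  by (simp add: emeasure_ball unit_ball_vol_2)

lemma measure_disc: "r \<ge> 0 \<Longrightarrow> measure lborel (ball (a::complex) r) = pi * r\<^sup>2"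
  by (simp add: content_ball unit_ball_vol_2)

lemma measure_cdisc: "r \<ge> 0 \<Longrightarrow> measure lborel (cball (a::complex) r) = pi * r\<^sup>2"
  by (simp add: content_cball unit_ball_vol_2)

lemma disc_integral_shift:
  assumes [measurable]: "u \<in> borel_measurable borel"
  shows "disc_integral (\<lambda>z. u (z + a)) 0 r = disc_integral u a r"
proof -
  have "disc_integral u a r = (\<integral>z. indicator (ball a r) (a + z) *\<^sub>R u (a + z) \<partial>lborel)"
    unfolding disc_integral_def set_lebesgue_integral_def
    by (subst lborel_distr_plus[of a, symmetric], subst integral_distr)
       (auto intro!: borel_measurable_times borel_measurable_indicator)
  also have "\<dots> = disc_integral (\<lambda>z. u (z + a)) 0 r"
    unfolding disc_integral_def set_lebesgue_integral_def
    by (intro Bochner_Integration.integral_cong) (auto simp: indicator_def dist_norm add.commute)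
  finally show ?thesis by simp
qed

locale plane_density =
  fixes u :: "complex \<Rightarrow> real"
  assumes measurable_u [measurable]: "u \<in> borel_measurable borel"
    and nonneg: "\<And>z. 0 \<le> u z"
    and le_one: "\<And>z. u z \<le> 1"
begin

abbreviation I where "I \<equiv> disc_integral u"

lemma set_integrable_bounded:
  assumes [measurable]: "S \<in> sets borel" and "bounded S"
    and [measurable]: "v \<in> borel_measurable borel" and "\<And>z. \<bar>v z\<bar> \<le> (C::real)"
  shows "set_integrable lborel (S :: complex set) v"
proof -
  have fin: "emeasure lborel S < \<infinity>"
    using emeasure_bounded_finite assms(2) by blast
  show ?thesis
    unfolding set_integrable_def
    by (rule integrableI_bounded_set[where A = S and B = C])
       (use fin assms(4) in \<open>auto simp: indicator_def less_top\<close>)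
qed

lemma set_integrable_u: "set_integrable lborel (ball a r) u"
  by (rule set_integrable_bounded[where C = 1]) (use nonneg le_one in auto)

lemma disc_integral_nonneg: "0 \<le> I a r"
  unfolding disc_integral_def set_lebesgue_integral_def
  by (rule integral_nonneg_AE) (auto simp: nonneg)

lemma nn_disc_integral: "(\<integral>\<^sup>+z\<in>ball a r. ennreal (u z) \<partial>lborel) = ennreal (I a r)"
proof -
  have "(\<integral>\<^sup>+z\<in>ball a r. ennreal (u z) \<partial>lborel) = (\<integral>\<^sup>+z. ennreal (indicator (ball a r) z * u z) \<partial>lborel)"
    by (intro nn_integral_cong) (auto simp: indicator_def)
  also have "\<dots> = ennreal (I a r)"
    using set_integrable_u unfolding set_integrable_def disc_integral_def set_lebesgue_integral_def
    by (subst nn_integral_eq_integral) (auto simp: nonneg)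
  finally show ?thesis .
qed

text \<open>Since \<open>u\<close> is at most 1, the integral of \<open>1 - u\<close> grows with the
  disc; written with areas, this is the claim.\<close>

lemma disc_integral_annulus:
  assumes "0 \<le> r" "r \<le> s"
  shows "I a s \<le> I a r + pi * (s\<^sup>2 - r\<^sup>2)"
proof -
  have "set_integrable lborel (ball a t) (\<lambda>z. 1 - u z)" for t
    by (rule set_integrable_bounded[where C = 1]) (use nonneg le_one in auto)
  then have "(LINT z:ball a r|lborel. 1 - u z) \<le> (LINT z:ball a s|lborel. 1 - u z)"
    unfolding set_lebesgue_integral_def set_integrable_def using le_one assms(2)
    by (intro integral_mono) (auto simp: indicator_def)
  moreover have "(LINT z:ball a t|lborel. 1 - u z) = pi * t\<^sup>2 - I a t" if "t \<ge> 0" for t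
  proof -
    have "(LINT z:ball a t|lborel. 1 - u z) = (LINT z:ball a t|lborel. 1) - I a t"
      unfolding disc_integral_def
      by (intro set_integral_diff set_integrable_u set_integrable_bounded[where C = 1]) auto
    also have "(LINT z:ball a t|lborel. 1::real) = pi * t\<^sup>2"
      using that by (simp add: set_lebesgue_integral_def measure_disc)
    finally show ?thesis .
  qed
  ultimately show ?thesis
    using assms by (simp add: right_diff_distrib)
qed

lemma disc_integral_le: "0 \<le> r \<Longrightarrow> I a r \<le> pi * r\<^sup>2"
  using disc_integral_annulus[of 0 r a] by (simp add: disc_integral_def set_lebesgue_integral_def)

lemma bdd_above_disc_integral: "0 \<le> r \<Longrightarrow> bdd_above (range (\<lambda>a. I a r))"
  using disc_integral_le by (auto intro!: bdd_aboveI)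

lemma disc_integral_le_mean_sup: "0 < r \<Longrightarrow> I a r \<le> mean_sup u r * (pi * r\<^sup>2)"
  using cSUP_upper[OF UNIV_I bdd_above_disc_integral, of r a] by (simp add: mean_sup_def)

lemma mean_sup_leI: "0 < r \<Longrightarrow> (\<And>a. I a r \<le> c * (pi * r\<^sup>2)) \<Longrightarrow> mean_sup u r \<le> c"
  unfolding mean_sup_def by (auto simp: divide_le_eq intro!: cSUP_least)

lemma mean_sup_nonneg: "0 < r \<Longrightarrow> 0 \<le> mean_sup u r"
  using order.trans[OF disc_integral_nonneg disc_integral_le_mean_sup[of r 0]]
  by (simp add: zero_le_mult_iff) (smt (verit) pi_gt_zero zero_less_power mult_pos_pos)

lemma disc_density_le: "0 < r \<Longrightarrow> disc_density u \<le> mean_sup u r"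
  unfolding disc_density_def
  by (rule cINF_lower) (auto intro!: bdd_belowI[where m = 0] mean_sup_nonneg)

lemma disc_density_nonneg: "0 \<le> disc_density u"
  unfolding disc_density_def by (rule cINF_greatest) (auto intro: mean_sup_nonneg)

lemma disc_density_less: "0 < e \<Longrightarrow> \<exists>s>0. mean_sup u s < disc_density u + e"
proof -
  assume "0 < e"
  then have "(INF r\<in>{0<..}. mean_sup u r) < disc_density u + e"
    by (simp add: disc_density_def)
  then show ?thesis
    by (subst (asm) cINF_less_iff) (auto intro!: bdd_belowI[where m = 0] mean_sup_nonneg)
qed

section \<open>Iterated averages over discs and convergence of the mean values\<close>

lemma measurable_u_snd [measurable]: "(\<lambda>p::complex \<times> complex. u (snd p)) \<in> borel_measurable borel"
  by (rule measurable_compose[OF borel_measurable_continuous_onI measurable_u]) (intro continuous_intros)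

lemma measurable_disc_integral [measurable]: "(\<lambda>b. I b s) \<in> borel_measurable borel"
proof -
  have [measurable]: "{p::complex \<times> complex. dist (fst p) (snd p) < s} \<in> sets borel"
    by (intro borel_open open_Collect_less continuous_intros)
  have "(\<lambda>p::complex \<times> complex. indicator {p. dist (fst p) (snd p) < s} p * u (snd p))
     \<in> borel_measurable (borel \<Otimes>\<^sub>M borel)"
    unfolding borel_prod by simp
  then have "(\<lambda>b. \<integral>z. indicator {p. dist (fst p) (snd p) < s} (b, z) * u z \<partial>lborel) \<in> borel_measurable borel"
    by (intro lborel.borel_measurable_lebesgue_integral) (simp add: case_prod_beta' cong: measurable_cong_sets)
  moreover have "(\<integral>z. indicator {p. dist (fst p) (snd p) < s} (b, z) * u z \<partial>lborel) = I b s" for b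
    unfolding disc_integral_def set_lebesgue_integral_def
    by (intro Bochner_Integration.integral_cong) (auto simp: indicator_def)
  ultimately show ?thesis by simp
qed

text \<open>Fubini for the pairs \<open>(b, z)\<close> with \<open>b\<close> in
  \<open>ball a r\<close> and \<open>dist b z < s\<close>: the weight of \<open>u z\<close> is the
  area of the set of admissible centres within distance \<open>s\<close> of
  \<open>z\<close>.\<close>

lemma nn_disc_integral_double:
  "(\<integral>\<^sup>+b\<in>ball a r. ennreal (I b s) \<partial>lborel) =
   (\<integral>\<^sup>+z. ennreal (u z) * emeasure lborel (ball a r \<inter> ball z s) \<partial>lborel)"
proof -
  have [measurable]: "{p::complex \<times> complex. dist (fst p) (snd p) < s} \<in> sets borel"
    by (intro borel_open open_Collect_less continuous_intros)
  define F :: "complex \<times> complex \<Rightarrow> ennreal" where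
    "F = (\<lambda>p. indicator (ball a r) (fst p) * indicator {p. dist (fst p) (snd p) < s} p * ennreal (u (snd p)))"
  have [simp]: "{p::complex \<times> complex. dist a (fst p) < r} \<in> sets borel"
    by (intro borel_open open_Collect_less continuous_intros)
  have "F = (\<lambda>p. indicator {p. dist a (fst p) < r} p * indicator {p. dist (fst p) (snd p) < s} p * ennreal (u (snd p)))"
    by (auto simp: F_def indicator_def)
  also have "\<dots> \<in> borel_measurable borel"
    by (intro borel_measurable_times_ennreal borel_measurable_indicator measurable_compose_rev[OF measurable_ennreal])
       simp_all
  finally have F: "F \<in> borel_measurable (lborel \<Otimes>\<^sub>M lborel)"
    by (simp add: lborel_prod)
  have "(\<integral>\<^sup>+b\<in>ball a r. ennreal (I b s) \<partial>lborel) = (\<integral>\<^sup>+b. \<integral>\<^sup>+z. F (b, z) \<partial>lborel \<partial>lborel)"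
  proof (intro nn_integral_cong)
    fix b
    have "ennreal (I b s) * indicator (ball a r) b =
        indicator (ball a r) b * (\<integral>\<^sup>+z\<in>ball b s. ennreal (u z) \<partial>lborel)"
      by (simp add: nn_disc_integral mult.commute)
    also have "\<dots> = (\<integral>\<^sup>+z. indicator (ball a r) b * (ennreal (u z) * indicator (ball b s) z) \<partial>lborel)"
      by (rule nn_integral_cmult[symmetric]) (auto intro!: borel_measurable_times_ennreal borel_measurable_indicator)
    also have "\<dots> = (\<integral>\<^sup>+z. F (b, z) \<partial>lborel)"
      by (intro nn_integral_cong) (auto simp: F_def indicator_def)
    finally show "ennreal (I b s) * indicator (ball a r) b = (\<integral>\<^sup>+z. F (b, z) \<partial>lborel)" .
  qed
  also have "\<dots> = (\<integral>\<^sup>+z. \<integral>\<^sup>+b. F (b, z) \<partial>lborel \<partial>lborel)"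
    by (rule lborel_pair.Fubini'[symmetric]) (use F in \<open>simp add: case_prod_beta'\<close>)
  also have "\<dots> = (\<integral>\<^sup>+z. ennreal (u z) * emeasure lborel (ball a r \<inter> ball z s) \<partial>lborel)"
  proof (intro nn_integral_cong)
    fix z
    have "(\<integral>\<^sup>+b. F (b, z) \<partial>lborel) = (\<integral>\<^sup>+b. ennreal (u z) * indicator (ball a r \<inter> ball z s) b \<partial>lborel)"
      by (intro nn_integral_cong) (auto simp: F_def indicator_def dist_commute)
    then show "(\<integral>\<^sup>+b. F (b, z) \<partial>lborel) = ennreal (u z) * emeasure lborel (ball a r \<inter> ball z s)"
      by (simp add: nn_integral_cmult_indicator)
  qed
  finally show ?thesis .
qed

lemma set_integrable_disc_integral:
  assumes "0 \<le> s" shows "set_integrable lborel (ball a r) (\<lambda>b. I b s)"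
  using assms by (intro set_integrable_bounded[where C = "pi * s\<^sup>2"])
    (auto simp: disc_integral_nonneg disc_integral_le)

lemma nn_set_integral_disc_integral:
  assumes "0 \<le> s"
  shows "(\<integral>\<^sup>+b\<in>ball a r. ennreal (I b s) \<partial>lborel) = ennreal (LINT b:ball a r|lborel. I b s)"
proof -
  have "(\<integral>\<^sup>+b\<in>ball a r. ennreal (I b s) \<partial>lborel) = (\<integral>\<^sup>+b. ennreal (indicator (ball a r) b * I b s) \<partial>lborel)"
    by (intro nn_integral_cong) (auto simp: indicator_def)
  also have "\<dots> = ennreal (LINT b:ball a r|lborel. I b s)"
    using set_integrable_disc_integral[OF assms] unfolding set_integrable_def set_lebesgue_integral_def
    by (subst nn_integral_eq_integral) (auto simp: disc_integral_nonneg)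
  finally show ?thesis .
qed

text \<open>The Fubini weight of \<open>z\<close> is at most the area of \<open>ball z s\<close>,
  and it vanishes unless \<open>z\<close> lies within \<open>r + s\<close> of
  \<open>a\<close>.\<close>

lemma integral_disc_integral_le:
  assumes "0 \<le> s"
  shows "(LINT b:ball a r|lborel. I b s) \<le> pi * s\<^sup>2 * I a (r + s)"
proof -
  have "ennreal (LINT b:ball a r|lborel. I b s) =
      (\<integral>\<^sup>+z. ennreal (u z) * emeasure lborel (ball a r \<inter> ball z s) \<partial>lborel)"
    using nn_disc_integral_double nn_set_integral_disc_integral[OF assms] by simp
  also have "\<dots> \<le> (\<integral>\<^sup>+z. ennreal (pi * s\<^sup>2) * (ennreal (u z) * indicator (ball a (r + s)) z) \<partial>lborel)"
  proof (intro nn_integral_mono)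
    fix z
    have "emeasure lborel (ball a r \<inter> ball z s) \<le> ennreal (pi * s\<^sup>2) * indicator (ball a (r + s)) z"
    proof (cases "z \<in> ball a (r + s)")
      case True
      then show ?thesis
        using emeasure_mono[of "ball a r \<inter> ball z s" "ball z s" lborel] emeasure_disc[OF assms, of z]
        by (simp add: indicator_def)
    next
      case False
      then have "ball a r \<inter> ball z s = {}"
        using dist_triangle_less_add[of a _ r z s] by (force simp: dist_commute)
      then show ?thesis by simp
    qed
    then show "ennreal (u z) * emeasure lborel (ball a r \<inter> ball z s) \<le>
        ennreal (pi * s\<^sup>2) * (ennreal (u z) * indicator (ball a (r + s)) z)"
      by (metis mult.left_commute mult_left_mono zero_le)
  qed
  also have "\<dots> = ennreal (pi * s\<^sup>2) * ennreal (I a (r + s))"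
    by (subst nn_integral_cmult) (measurable, simp_all add: nn_disc_integral)
  also have "\<dots> = ennreal (pi * s\<^sup>2 * I a (r + s))"
    by (simp add: ennreal_mult' )
  finally show ?thesis
    by (simp add: ennreal_le_iff disc_integral_nonneg)
qed

text \<open>For \<open>z\<close> in \<open>ball a r\<close> the disc \<open>ball z s\<close> lies
  inside \<open>ball a (r + s)\<close>, so such \<open>z\<close> carry the full weight
  \<open>pi * s\<^sup>2\<close>.\<close>

lemma integral_disc_integral_ge:
  assumes "0 \<le> s"
  shows "pi * s\<^sup>2 * I a r \<le> (LINT b:ball a (r + s)|lborel. I b s)"
proof -
  have "ennreal (pi * s\<^sup>2 * I a r) = ennreal (pi * s\<^sup>2) * ennreal (I a r)"
    by (simp add: ennreal_mult')
  also have "\<dots> = (\<integral>\<^sup>+z. ennreal (pi * s\<^sup>2) * (ennreal (u z) * indicator (ball a r) z) \<partial>lborel)"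
    by (subst nn_integral_cmult) (measurable, simp_all add: nn_disc_integral)
  also have "\<dots> \<le> (\<integral>\<^sup>+z. ennreal (u z) * emeasure lborel (ball a (r + s) \<inter> ball z s) \<partial>lborel)"
  proof (intro nn_integral_mono)
    fix z
    have "ball a (r + s) \<inter> ball z s = ball z s" if "z \<in> ball a r"
      using that dist_triangle_less_add[of a z r _ s] by (force simp: dist_commute)
    then show "ennreal (pi * s\<^sup>2) * (ennreal (u z) * indicator (ball a r) z) \<le>
        ennreal (u z) * emeasure lborel (ball a (r + s) \<inter> ball z s)"
      using emeasure_disc[OF assms, of z] by (auto simp: indicator_def mult.commute)
  qed
  also have "\<dots> = ennreal (LINT b:ball a (r + s)|lborel. I b s)"
    using nn_disc_integral_double nn_set_integral_disc_integral[OF assms] by simp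
  finally show ?thesis
    by (subst (asm) ennreal_le_iff)
       (auto simp: set_lebesgue_integral_def disc_integral_nonneg intro!: integral_nonneg_AE)
qed

text \<open>Replacing \<open>u\<close> by its averages at scale \<open>s\<close> costs only an
  enlargement of the disc by \<open>s\<close>, and each average is at most
  \<open>mean_sup u s\<close>. The factor is the ratio of the areas of the two discs.\<close>

lemma mean_sup_submult:
  assumes "0 < s" "0 < r"
  shows "mean_sup u r \<le> mean_sup u s * (1 + s / r)\<^sup>2"
proof (rule mean_sup_leI[OF assms(2)])
  fix a
  have "pi * s\<^sup>2 * I a r \<le> (LINT b:ball a (r + s)|lborel. I b s)"
    using integral_disc_integral_ge assms by simp
  also have "\<dots> \<le> (LINT b:ball a (r + s)|lborel. mean_sup u s * (pi * s\<^sup>2))"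
    using assms by (intro set_integral_mono set_integrable_disc_integral disc_integral_le_mean_sup
        set_integrable_bounded[where C = "\<bar>mean_sup u s * (pi * s\<^sup>2)\<bar>"]) auto
  also have "\<dots> = mean_sup u s * (pi * s\<^sup>2) * (pi * (r + s)\<^sup>2)"
    using assms by (simp add: set_lebesgue_integral_def measure_disc)
  finally have "I a r \<le> mean_sup u s * (pi * (r + s)\<^sup>2)"
    using assms by (simp add: field_simps)
  also have "\<dots> = mean_sup u s * (1 + s / r)\<^sup>2 * (pi * r\<^sup>2)"
    using assms by (simp add: field_simps power2_eq_square)
  finally show "I a r \<le> mean_sup u s * (1 + s / r)\<^sup>2 * (pi * r\<^sup>2)" .
qed

lemma tendsto_mean_sup: "(mean_sup u \<longlongrightarrow> disc_density u) at_top"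
proof (rule order_tendstoI)
  fix y assume y: "y < disc_density u"
  show "\<forall>\<^sub>F r in at_top. y < mean_sup u r"
    using eventually_gt_at_top[of "0::real"]
    by eventually_elim (rule less_le_trans[OF y disc_density_le])
next
  fix y assume y: "disc_density u < y"
  then obtain s where s: "s > 0" "mean_sup u s < y"
    using disc_density_less[of "y - disc_density u"] by auto
  have "((\<lambda>r. mean_sup u s * (1 + s / r)\<^sup>2) \<longlongrightarrow> mean_sup u s * (1 + 0)\<^sup>2) at_top"
    by (intro tendsto_intros real_tendsto_divide_at_top[where c = s] filterlim_ident)
  then have "\<forall>\<^sub>F r in at_top. mean_sup u s * (1 + s / r)\<^sup>2 < y"
    by (rule order_tendstoD) (use s in simp)
  then show "\<forall>\<^sub>F r in at_top. mean_sup u r < y"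
    using eventually_gt_at_top[of 0]
    by eventually_elim (rule le_less_trans[OF mean_sup_submult[OF s(1)]])
qed


section \<open>Covering by bad discs and existence of good centres\<close>

text \<open>The deficit \<open>w\<close> of the \<open>s\<close>-averages below their supremum is
  nonnegative, so its integral over the large disc is at least its sum over disjoint bad discs.
  Vitali's factor 5 in the radius, squared, leaves these discs at least 1/25 of the area of the disc
  of radius \<open>L - R\<close>.\<close>

lemma Vitali_disc_integral_le:
  assumes s: "0 < s" and R: "0 < R" "R < L"
    and rad: "\<And>b. 0 < rad b \<and> rad b \<le> R"
    and bad: "\<And>b. I b (rad b + s) \<le> (mean_sup u s - d) * (pi * (rad b)\<^sup>2)" and "0 \<le> d"
  shows "I a L \<le> mean_sup u s * (pi * (L + s)\<^sup>2) - d / 25 * (pi * (L - R)\<^sup>2)"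
proof -
  define M where "M = mean_sup u s"
  \<comment> \<open>Centres within \<open>L - R\<close> of \<open>a\<close> and radii at most
    \<open>R\<close> keep every bad disc inside \<open>ball a L\<close>; a finite subcover makes the
    later sums finite.\<close>
  have "cball a (L - R) \<subseteq> (\<Union>b\<in>cball a (L - R). ball b (rad b))"
    using rad by force
  then obtain K where K: "K \<subseteq> cball a (L - R)" "finite K" "cball a (L - R) \<subseteq> (\<Union>b\<in>K. ball b (rad b))"
    using compactE_image[OF compact_cball, of "cball a (L - R)" "\<lambda>b. ball b (rad b)" a "L - R"] by auto
  then have "cball a (L - R) \<subseteq> (\<Union>b\<in>K. cball b (rad b))"
    using ball_subset_cball by blast
  then obtain C where
    C: "C \<subseteq> K" "pairwise (\<lambda>b c. disjnt (cball b (rad b)) (cball c (rad c))) C"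
       "cball a (L - R) \<subseteq> (\<Union>b\<in>C. cball b (5 * rad b))"
    by (rule Vitali_covering_lemma_cballs[where a = "\<lambda>b. b" and r = rad and B = R]) (use rad in simp)
  have "finite C" using C(1) K(2) finite_subset by blast
  define T where "T = (\<Sum>b\<in>C. pi * (rad b)\<^sup>2)"
  have "pi * (L - R)\<^sup>2 = measure lborel (cball a (L - R))"
    using R by (simp add: measure_cdisc)
  also have "\<dots> \<le> measure lborel (\<Union>b\<in>C. cball b (5 * rad b))"
    using C(3) \<open>finite C\<close> by (intro measure_mono_fmeasurable fmeasurable.finite_UN fmeasurable_compact) auto
  also have "\<dots> \<le> (\<Sum>b\<in>C. measure lborel (cball b (5 * rad b)))"
    using \<open>finite C\<close> by (intro measure_UNION_le) auto
  also have "\<dots> = 25 * T"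
    unfolding T_def sum_distrib_left using rad
    by (intro sum.cong) (auto simp: measure_cdisc less_imp_le power2_eq_square)
  finally have T: "pi * (L - R)\<^sup>2 \<le> 25 * T" .
  define w where "w = (\<lambda>b. M * (pi * s\<^sup>2) - I b s)"
  have w: "0 \<le> w b" "\<bar>w b\<bar> \<le> M * (pi * s\<^sup>2)" for b
    using disc_integral_le_mean_sup[OF s, of b] disc_integral_nonneg[of b s] by (auto simp: w_def M_def)
  have w_int: "set_integrable lborel S w" if "S \<in> sets borel" "bounded S" for S
    by (rule set_integrable_bounded[where C = "M * (pi * s\<^sup>2)"]) (use that w in \<open>auto simp: w_def\<close>)
  have w_ball: "(LINT z:ball b t|lborel. w z) = M * (pi * s\<^sup>2) * (pi * t\<^sup>2) - (LINT z:ball b t|lborel. I z s)"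
    if "0 \<le> t" for b t
  proof -
    have "(LINT z:ball b t|lborel. w z) = (LINT z:ball b t|lborel. M * (pi * s\<^sup>2)) - (LINT z:ball b t|lborel. I z s)"
      unfolding w_def using s
      by (intro set_integral_diff set_integrable_disc_integral
          set_integrable_bounded[where C = "\<bar>M * (pi * s\<^sup>2)\<bar>"]) auto
    then show ?thesis
      using that by (simp add: set_lebesgue_integral_def measure_disc)
  qed
  have "pi * s\<^sup>2 * (d * T) = (\<Sum>b\<in>C. pi * s\<^sup>2 * (d * (pi * (rad b)\<^sup>2)))"
    by (simp add: T_def sum_distrib_left)
  also have "\<dots> \<le> (\<Sum>b\<in>C. LINT z:ball b (rad b)|lborel. w z)"
  proof (rule sum_mono)
    fix b
    \<comment> \<open>Discs of radius \<open>s\<close> centred in \<open>ball b (rad b)\<close>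
      reach out to radius \<open>rad b + s\<close>, which is why \<open>bad\<close> is assumed at
      that radius.\<close>
    have "(LINT z:ball b (rad b)|lborel. I z s) \<le> pi * s\<^sup>2 * I b (rad b + s)"
      using s by (intro integral_disc_integral_le) auto
    also have "\<dots> \<le> pi * s\<^sup>2 * ((M - d) * (pi * (rad b)\<^sup>2))"
      using bad[of b] by (intro mult_left_mono) (auto simp: M_def)
    finally show "pi * s\<^sup>2 * (d * (pi * (rad b)\<^sup>2)) \<le> (LINT z:ball b (rad b)|lborel. w z)"
      using rad[of b] by (simp add: w_ball algebra_simps)
  qed
  also have "\<dots> = (LINT z:(\<Union>b\<in>C. ball b (rad b))|lborel. w z)"
  proof (rule set_integral_finite_Union[symmetric])
    show "disjoint_family_on (\<lambda>b. ball b (rad b)) C"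
      unfolding disjoint_family_on_def
    proof (intro ballI impI)
      fix b c assume "b \<in> C" "c \<in> C" "b \<noteq> c"
      then have "cball b (rad b) \<inter> cball c (rad c) = {}"
        using C(2) unfolding pairwise_def disjnt_def by blast
      then show "ball b (rad b) \<inter> ball c (rad c) = {}"
        using ball_subset_cball by blast
    qed
  qed (use \<open>finite C\<close> w_int in auto)
  also have "\<dots> \<le> (LINT z:ball a (L + s)|lborel. w z)"
  proof -
    have "ball b (rad b) \<subseteq> ball a (L + s)" if "b \<in> C" for b
    proof
      fix z assume "z \<in> ball b (rad b)"
      moreover have "dist a b \<le> L - R" using that C(1) K(1) by auto
      ultimately show "z \<in> ball a (L + s)"
        using dist_triangle[of a z b] rad[of b] s by auto
    qed
    moreover define U where "U = (\<Union>b\<in>C. ball b (rad b))"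
    ultimately have U: "U \<subseteq> ball a (L + s)" "U \<in> sets borel"
      by (auto simp: U_def intro!: borel_open open_UN)
    then have "indicator U z * w z \<le> indicator (ball a (L + s)) z * w z" for z
      using w(1)[of z] by (auto simp: indicator_def)
    then show ?thesis
      using w_int[of "ball a (L + s)"] w_int[OF U(2)] bounded_subset[OF bounded_ball U(1)]
      unfolding set_lebesgue_integral_def set_integrable_def U_def[symmetric]
      by (intro integral_mono) auto
  qed
  also have "\<dots> \<le> M * (pi * s\<^sup>2) * (pi * (L + s)\<^sup>2) - pi * s\<^sup>2 * I a L"
    using integral_disc_integral_ge[of s a L] R s by (simp add: w_ball)
  finally have "pi * s\<^sup>2 * (d * T) \<le> pi * s\<^sup>2 * (M * (pi * (L + s)\<^sup>2) - I a L)"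
    by (simp add: algebra_simps)
  then have "d * T \<le> M * (pi * (L + s)\<^sup>2) - I a L"
    using s by (subst (asm) mult_le_cancel_left_pos) auto
  moreover have "d * (pi * (L - R)\<^sup>2) \<le> d * (25 * T)"
    using T \<open>0 \<le> d\<close> by (rule mult_left_mono)
  ultimately show ?thesis
    by (simp add: M_def)
qed

lemma good_centre:
  assumes e: "0 < e"
  obtains r0 where "1 \<le> r0" "\<forall>R. \<exists>a. \<forall>r\<in>{r0..R}. (disc_density u - e) * (pi * r\<^sup>2) \<le> I a r"
proof -
  define \<rho> where "\<rho> = disc_density u"
  \<comment> \<open>Bad discs will have deficit \<open>e / 2\<close>, of which the covering retains
    1/25; hence the margin \<open>e / 50\<close>.\<close>
  obtain s where s: "0 < s" and Ms: "mean_sup u s < \<rho> + e / 50"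
    using disc_density_less[of "e / 50"] e by (auto simp: \<rho>_def)
  \<comment> \<open>For \<open>r \<ge> r0\<close> the annulus from \<open>r\<close> to
    \<open>r + s\<close> has area at most \<open>3 * pi * s * r\<close>, hence at most
    \<open>e / 2\<close> times that of the disc of radius \<open>r\<close>: a bad disc widened by
    \<open>s\<close> stays bad with \<open>e / 2\<close>. The bound \<open>1 \<le> r0\<close> fits
    the lower limit of the characteristic function.\<close>
  define r0 where "r0 = max 1 (max s (6 * s / e))"
  have r0: "1 \<le> r0" "s \<le> r0" "6 * s / e \<le> r0" by (auto simp: r0_def)
  have "\<exists>a. \<forall>r\<in>{r0..R}. (\<rho> - e) * (pi * r\<^sup>2) \<le> I a r" for R
  proof (rule ccontr)
    assume "\<nexists>a. \<forall>r\<in>{r0..R}. (\<rho> - e) * (pi * r\<^sup>2) \<le> I a r"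
    then have "\<forall>b. \<exists>r. r0 \<le> r \<and> r \<le> R \<and> I b r < (\<rho> - e) * (pi * r\<^sup>2)"
      by (force simp: not_le)
    then obtain rad where rad: "\<And>b. r0 \<le> rad b" "\<And>b. rad b \<le> R"
      and lt: "\<And>b. I b (rad b) < (\<rho> - e) * (pi * (rad b)\<^sup>2)" by metis
    have rad_pos: "0 < rad b" for b using r0(1) rad(1)[of b] by linarith
    have R: "0 < R" using r0 rad[of 0] by linarith
    have bad: "I b (rad b + s) \<le> (mean_sup u s - e / 2) * (pi * (rad b)\<^sup>2)" for b
    proof -
      define r where "r = rad b"
      have r: "s \<le> r" "6 * s \<le> e * r" "0 < r"
        using r0(1,2) order.trans[OF r0(3) rad(1)[of b]] rad(1)[of b] e s
        by (auto simp: r_def field_simps)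
      have "(r + s)\<^sup>2 - r\<^sup>2 = s * (2 * r + s)" by (simp add: power2_eq_square algebra_simps)
      also have "\<dots> \<le> s * (3 * r)" using r s by (intro mult_left_mono) auto
      also have "\<dots> \<le> e / 2 * r\<^sup>2" using mult_right_mono[OF r(2), of "r / 2"] r(3) by (simp add: power2_eq_square)
      finally have "pi * ((r + s)\<^sup>2 - r\<^sup>2) \<le> pi * (e / 2 * r\<^sup>2)"
        by (rule mult_left_mono) simp
      moreover define q where "q = pi * r\<^sup>2"
      ultimately have "pi * ((r + s)\<^sup>2 - r\<^sup>2) \<le> e / 2 * q"
        by (simp only: mult.left_commute[of pi])
      moreover have "I b (r + s) \<le> I b r + pi * ((r + s)\<^sup>2 - r\<^sup>2)"
        using r s by (intro disc_integral_annulus) auto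
      moreover have "\<rho> * q \<le> mean_sup u s * q"
        using disc_density_le[OF s] by (intro mult_right_mono) (auto simp: \<rho>_def q_def)
      moreover have "I b r < (\<rho> - e) * q"
        using lt[of b] by (simp add: r_def q_def)
      ultimately have "I b (r + s) \<le> (mean_sup u s - e / 2) * q"
        by (simp add: left_diff_distrib)
      then show ?thesis
        by (simp add: r_def q_def)
    qed
    have "mean_sup u L \<le> mean_sup u s * (1 + s / L)\<^sup>2 - e / 50 * (1 - R / L)\<^sup>2" if L: "R < L" for L
    proof (rule mean_sup_leI)
      show "0 < L" using R L by simp
      fix a
      have "I a L \<le> mean_sup u s * (pi * (L + s)\<^sup>2) - (e / 2) / 25 * (pi * (L - R)\<^sup>2)"
        by (rule Vitali_disc_integral_le[where rad = rad])
           (use s R L rad(2) rad_pos bad e in auto)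
      also have "\<dots> = (mean_sup u s * (1 + s / L)\<^sup>2 - e / 50 * (1 - R / L)\<^sup>2) * (pi * L\<^sup>2)"
        using \<open>0 < L\<close> by (simp add: field_simps power2_eq_square)
      finally show "I a L \<le> (mean_sup u s * (1 + s / L)\<^sup>2 - e / 50 * (1 - R / L)\<^sup>2) * (pi * L\<^sup>2)" .
    qed
    then have "\<rho> \<le> mean_sup u s * (1 + s / L)\<^sup>2 - e / 50 * (1 - R / L)\<^sup>2" if "R < L" for L
      using disc_density_le[of L] that R unfolding \<rho>_def by (meson order.trans less_trans)
    then have "\<forall>\<^sub>F L in at_top. \<rho> \<le> mean_sup u s * (1 + s / L)\<^sup>2 - e / 50 * (1 - R / L)\<^sup>2"
      by (rule eventually_mono[OF eventually_gt_at_top[of R]])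
    moreover have "((\<lambda>L. mean_sup u s * (1 + s / L)\<^sup>2 - e / 50 * (1 - R / L)\<^sup>2)
        \<longlongrightarrow> mean_sup u s * (1 + 0)\<^sup>2 - e / 50 * (1 - 0)\<^sup>2) at_top"
      by (intro tendsto_intros real_tendsto_divide_at_top[where c = s]
          real_tendsto_divide_at_top[where c = R] filterlim_ident)
    ultimately have "\<rho> \<le> mean_sup u s * (1 + 0)\<^sup>2 - e / 50 * (1 - 0)\<^sup>2"
      by (intro tendsto_lowerbound[where F = at_top]) auto
    with Ms show False by simp
  qed
  with r0(1) that show ?thesis by (auto simp: \<rho>_def)
qed

section \<open>The characteristic function in terms of disc integrals\<close>

definition char_fun :: "real \<Rightarrow> ennreal" where
  "char_fun r = (\<integral>\<^sup>+t\<in>{1..r}. (ennreal (I 0 t) * ennreal (1 / t)) \<partial>lborel)"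

lemma nn_integral_linear:
  assumes "0 \<le> a" "a \<le> b" "0 \<le> c" "0 \<le> d"
  shows "(\<integral>\<^sup>+t\<in>{a..b}. ennreal (c * t + d) \<partial>lborel) = ennreal (c * (b\<^sup>2 - a\<^sup>2) / 2 + d * (b - a))"
proof -
  have "(\<integral>\<^sup>+t\<in>{a..b}. ennreal (c * t + d) \<partial>lborel) =
      ennreal ((c * b\<^sup>2 / 2 + d * b) - (c * a\<^sup>2 / 2 + d * a))"
  proof (rule nn_integral_FTC_Icc)
    show "((\<lambda>t. c * t\<^sup>2 / 2 + d * t) has_real_derivative c * x + d) (at x)" for x
      by (auto intro!: derivative_eq_intros)
  qed (use assms in \<open>auto intro!: add_nonneg_nonneg mult_nonneg_nonneg\<close>)
  then show ?thesis by (simp add: algebra_simps diff_divide_distrib)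
qed

text \<open>Only radii from \<open>r0\<close> to \<open>r\<close> are kept. There the integrand is
  at least \<open>k * pi * t\<close>, with integral
  \<open>k * pi * (r\<^sup>2 - r0\<^sup>2) / 2\<close>, and the normalisation
  \<open>2 / (pi * r\<^sup>2)\<close> turns this into nearly \<open>k\<close>.\<close>

lemma char_fun_ge:
  assumes r0: "1 \<le> r0" "r0 \<le> r" and k: "0 \<le> k"
    and ge: "\<And>t. r0 \<le> t \<Longrightarrow> k * (pi * t\<^sup>2) \<le> I 0 t"
  shows "ennreal (2 / (pi * r\<^sup>2)) * char_fun r \<ge> ennreal (k * (1 - (r0 / r)\<^sup>2))"
proof -
  have "ennreal (k * pi * (r\<^sup>2 - r0\<^sup>2) / 2) = (\<integral>\<^sup>+t\<in>{r0..r}. ennreal (k * pi * t + 0) \<partial>lborel)"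
    using assms by (subst nn_integral_linear) auto
  also have "\<dots> \<le> char_fun r"
    unfolding char_fun_def
  proof (intro nn_integral_mono)
    fix t
    have "k * pi * t \<le> I 0 t * (1 / t)" if "r0 \<le> t"
      using ge[OF that] that r0 by (simp add: field_simps power2_eq_square)
    then show "ennreal (k * pi * t + 0) * indicator {r0..r} t \<le> ennreal (I 0 t) * ennreal (1 / t) * indicator {1..r} t"
      using r0 by (auto simp: indicator_def disc_integral_nonneg simp flip: ennreal_mult' intro!: ennreal_leI)
  qed
  finally have "ennreal (2 / (pi * r\<^sup>2)) * ennreal (k * pi * (r\<^sup>2 - r0\<^sup>2) / 2) \<le> ennreal (2 / (pi * r\<^sup>2)) * char_fun r"
    by (rule mult_left_mono) simp
  moreover have "ennreal (2 / (pi * r\<^sup>2)) * ennreal (k * pi * (r\<^sup>2 - r0\<^sup>2) / 2) = ennreal (k * (1 - (r0 / r)\<^sup>2))"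
    using r0 by (subst ennreal_mult'[symmetric])
      (auto simp: divide_simps power2_eq_square right_diff_distrib intro!: arg_cong[where f = ennreal])
  ultimately show ?thesis by simp
qed

lemma Liminf_char_fun_ge:
  assumes r0: "1 \<le> r0" and ge: "\<And>t. r0 \<le> t \<Longrightarrow> k * (pi * t\<^sup>2) \<le> I 0 t"
  shows "ennreal k \<le> Liminf at_top (\<lambda>r. ennreal (2 / (pi * r\<^sup>2)) * char_fun r)"
proof (cases "0 \<le> k")
  case True
  have "((\<lambda>r. ennreal (k * (1 - (r0 / r)\<^sup>2))) \<longlongrightarrow> ennreal (k * (1 - 0\<^sup>2))) at_top"
    by (intro tendsto_intros real_tendsto_divide_at_top[where c = r0] filterlim_ident)
  then have "ennreal k = Liminf at_top (\<lambda>r. ennreal (k * (1 - (r0 / r)\<^sup>2)))"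
    by (subst lim_imp_Liminf) auto
  also have "\<dots> \<le> Liminf at_top (\<lambda>r. ennreal (2 / (pi * r\<^sup>2)) * char_fun r)"
    by (rule Liminf_mono, rule eventually_mono[OF eventually_ge_at_top[of r0]])
       (use char_fun_ge[OF r0 _ True ge] in auto)
  finally show ?thesis .
\<comment> \<open>For negative \<open>k\<close> the left-hand side \<open>ennreal k\<close> is
  0.\<close>
qed (simp add: ennreal_neg)

lemma Limsup_char_fun_le:
  "Limsup at_top (\<lambda>r. ennreal (2 / (pi * r\<^sup>2)) * char_fun r) \<le> ennreal (disc_density u)"
proof (rule ennreal_le_epsilon)
  fix e :: real assume e: "0 < e"
  define k where "k = disc_density u + e"
  have k: "0 \<le> k" using e disc_density_nonneg by (simp add: k_def)
  have "\<forall>\<^sub>F r in at_top. mean_sup u r < k"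
    by (rule order_tendstoD[OF tendsto_mean_sup]) (use e in \<open>simp add: k_def\<close>)
  then obtain r0' where r0': "\<And>r. r0' \<le> r \<Longrightarrow> mean_sup u r < k"
    by (auto simp: eventually_at_top_linorder)
  define r0 where "r0 = max 1 r0'"
  have r0: "1 \<le> r0" "\<And>r. r0 \<le> r \<Longrightarrow> mean_sup u r < k" using r0' by (auto simp: r0_def)
  \<comment> \<open>Below \<open>r0\<close> the trivial bound \<open>pi * t\<^sup>2\<close> is at
    most \<open>pi * r0 * t\<close>, so adding the constant \<open>pi * r0\<close> covers both
    ranges of \<open>t\<close>; after normalisation it contributes at most
    \<open>2 * r0 / r\<close>.\<close>
  have le: "I 0 t * (1 / t) \<le> k * pi * t + pi * r0" if t: "1 \<le> t" for t
  proof -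
    have "I 0 t \<le> k * (pi * t\<^sup>2) + pi * r0 * t"
    proof (cases "r0 \<le> t")
      case True
      have "I 0 t \<le> mean_sup u t * (pi * t\<^sup>2)" using t by (intro disc_integral_le_mean_sup) auto
      also have "\<dots> \<le> k * (pi * t\<^sup>2)" using r0(2)[OF True] by (intro mult_right_mono) auto
      finally show ?thesis using r0 t by (simp add: add_increasing2)
    next
      case False
      have "I 0 t \<le> pi * t\<^sup>2" using t by (intro disc_integral_le) auto
      also have "\<dots> \<le> pi * r0 * t" using False t by (simp add: power2_eq_square)
      finally show ?thesis using k by (simp add: add_increasing)
    qed
    then show ?thesis using t by (simp add: field_simps power2_eq_square)
  qed
  have "ennreal (2 / (pi * r\<^sup>2)) * char_fun r \<le> ennreal (k + 2 * r0 / r)" if r: "1 \<le> r" for r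
  proof -
    have "char_fun r \<le> (\<integral>\<^sup>+t\<in>{1..r}. ennreal (k * pi * t + pi * r0) \<partial>lborel)"
      unfolding char_fun_def
      by (intro nn_integral_mono)
         (auto simp: indicator_def disc_integral_nonneg simp flip: ennreal_mult' intro!: ennreal_leI le[simplified])
    also have "\<dots> = ennreal (k * pi * (r\<^sup>2 - 1\<^sup>2) / 2 + pi * r0 * (r - 1))"
      using r r0 k by (subst nn_integral_linear) auto
    also have "\<dots> \<le> ennreal (k * pi * r\<^sup>2 / 2 + pi * r0 * r)"
      using k r0 by (intro ennreal_leI add_mono divide_right_mono mult_left_mono) auto
    finally have "ennreal (2 / (pi * r\<^sup>2)) * char_fun r \<le> ennreal (2 / (pi * r\<^sup>2)) * ennreal (k * pi * r\<^sup>2 / 2 + pi * r0 * r)"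
      by (rule mult_left_mono) simp
    also have "\<dots> = ennreal (k + 2 * r0 / r)"
      using r by (subst ennreal_mult'[symmetric])
        (auto simp: divide_simps power2_eq_square distrib_left intro!: arg_cong[where f = ennreal])
    finally show ?thesis .
  qed
  then have "Limsup at_top (\<lambda>r. ennreal (2 / (pi * r\<^sup>2)) * char_fun r) \<le> Limsup at_top (\<lambda>r. ennreal (k + 2 * r0 / r))"
    by (intro Limsup_mono eventually_mono[OF eventually_ge_at_top[of 1]]) auto
  also have "((\<lambda>r. ennreal (k + 2 * r0 / r)) \<longlongrightarrow> ennreal (k + 0)) at_top"
    by (intro tendsto_intros real_tendsto_divide_at_top[where c = "2 * r0"] filterlim_ident)
  then have "Limsup at_top (\<lambda>r. ennreal (k + 2 * r0 / r)) = ennreal (disc_density u) + ennreal e"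
    using e disc_density_nonneg by (subst lim_imp_Limsup) (auto simp: k_def)
  finally show "Limsup at_top (\<lambda>r. ennreal (2 / (pi * r\<^sup>2)) * char_fun r) \<le> ennreal (disc_density u) + ennreal e" .
qed

lemma Lim_SUP_disc_integral:
  "Lim at_top (\<lambda>r. ennreal (1 / (pi * r\<^sup>2)) * (SUP a. ennreal (I a r))) = ennreal (disc_density u)"
proof (rule tendsto_Lim)
  have "\<forall>\<^sub>F r in at_top. ennreal (mean_sup u r) = ennreal (1 / (pi * r\<^sup>2)) * (SUP a. ennreal (I a r))"
    using eventually_gt_at_top[of 0]
  proof eventually_elim
    case (elim r)
    have "(SUP a. ennreal (I a r)) = ennreal (SUP a. I a r)"
    proof (rule antisym)
      show "(SUP a. ennreal (I a r)) \<le> ennreal (SUP a. I a r)"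
        using elim by (intro SUP_least ennreal_leI cSUP_upper bdd_above_disc_integral) auto
      have "(SUP a. ennreal (I a r)) \<le> ennreal (pi * r\<^sup>2)"
        using elim by (intro SUP_least ennreal_leI disc_integral_le) auto
      then obtain s where s: "0 \<le> s" "(SUP a. ennreal (I a r)) = ennreal s"
        by (cases "SUP a. ennreal (I a r)") (auto simp: top_unique)
      then have "I a r \<le> s" for a
        using SUP_upper[of a UNIV "\<lambda>a. ennreal (I a r)"] by simp
      then show "ennreal (SUP a. I a r) \<le> (SUP a. ennreal (I a r))"
        unfolding s(2) by (intro ennreal_leI cSUP_least) auto
    qed
    then show ?case
      by (simp add: mean_sup_def flip: ennreal_mult')
  qed
  moreover have "((\<lambda>r. ennreal (mean_sup u r)) \<longlongrightarrow> ennreal (disc_density u)) at_top"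
    by (intro tendsto_ennrealI tendsto_mean_sup)
  ultimately show "((\<lambda>r. ennreal (1 / (pi * r\<^sup>2)) * (SUP a. ennreal (I a r))) \<longlongrightarrow> ennreal (disc_density u)) at_top"
    by (rule Lim_transform_eventually[rotated])
qed auto

end

section \<open>Speed of Brody curves in charts\<close>

text \<open>A finite net of \<open>S\<close> is controlled at once, and every other point is
  compared with a nearby net point through the common Lipschitz constant, which the limit inherits.
  The filter is arbitrary because limits will be taken along neighbourhood filters.\<close>

lemma uniform_limit_equi_lipschitz:
  fixes f :: "'i \<Rightarrow> 'a::metric_space \<Rightarrow> 'b::metric_space"
  assumes S: "compact S" and "0 \<le> L" and F: "F \<noteq> bot"
    and lip: "\<forall>\<^sub>F i in F. \<forall>x\<in>S. \<forall>y\<in>S. dist (f i x) (f i y) \<le> L * dist x y"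
    and lim: "\<And>x. x \<in> S \<Longrightarrow> ((\<lambda>i. f i x) \<longlongrightarrow> g x) F"
  shows "uniform_limit S f g F"
proof (rule uniform_limitI)
  fix e :: real assume e: "0 < e"
  have lip_g: "dist (g x) (g y) \<le> L * dist x y" if "x \<in> S" "y \<in> S" for x y
    by (rule tendsto_le[OF F tendsto_const tendsto_dist[OF lim lim]])
       (use that lip in \<open>auto elim: eventually_mono\<close>)
  \<comment> \<open>Passing to a net point costs less than \<open>e / 3\<close> for
    \<open>f i\<close> and for \<open>g\<close>; the \<open>+ 1\<close> covers
    \<open>L = 0\<close>.\<close>
  define d where "d = e / (3 * (L + 1))"
  have d: "0 < d" "L * d < e / 3" using e \<open>0 \<le> L\<close> by (auto simp: d_def field_simps)
  obtain T where T: "finite T" "T \<subseteq> S" "S \<subseteq> (\<Union>t\<in>T. ball t d)"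
    using compactE_image[OF S, of S "\<lambda>t. ball t d"] d(1) by (metis centre_in_ball open_ball subsetI UN_I)
  have "\<forall>\<^sub>F i in F. \<forall>t\<in>T. dist (f i t) (g t) < e / 3"
    using T e lim by (intro eventually_ball_finite ballI tendstoD) auto
  with lip show "\<forall>\<^sub>F i in F. \<forall>x\<in>S. dist (f i x) (g x) < e"
  proof eventually_elim
    case (elim i)
    show ?case
    proof
      fix x assume x: "x \<in> S"
      then obtain t where t: "t \<in> T" "dist t x < d" using T(3) by auto
      have Ld: "L * dist t x < e / 3"
        using mult_left_mono[OF less_imp_le[OF t(2)] \<open>0 \<le> L\<close>] d(2) by linarith
      have "dist (f i x) (g x) \<le> dist (f i x) (f i t) + dist (f i t) (g t) + dist (g t) (g x)"
        using dist_triangle[of "f i x" "g x" "f i t"] dist_triangle[of "f i t" "g x" "g t"] by linarith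
      moreover have "dist (f i x) (f i t) \<le> L * dist t x" "dist (g t) (g x) \<le> L * dist t x"
        "dist (f i t) (g t) < e / 3"
        using elim lip_g t T(2) x by (auto simp: dist_commute)
      ultimately show "dist (f i x) (g x) < e" using Ld by linarith
    qed
  qed
qed

lemma hermitian_form_scale:
  "hermitian_form H (a *s u) (b *s v) = a * cnj b * hermitian_form H u v"
  by (simp add: hermitian_form_def sum_distrib_left mult_ac)

lemma norm_vector_scale: "norm (a *s v) = norm a * norm (v :: complex^'n)"
  by (simp add: norm_vec_def L2_set_right_distrib norm_mult)

definition chart_deriv :: "('a, 'n::finite) chart \<Rightarrow> (complex \<Rightarrow> 'a) \<Rightarrow> complex \<Rightarrow> complex^'n" where
  "chart_deriv c f z = (\<chi> i. deriv (\<lambda>w. snd c (f w) $ i) z)"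

text \<open>The filter lives on the maps themselves, so neighbourhood filters of a function space
  can be used directly. Where \<open>g z\<close> lies outside \<open>topspace X\<close> the
  condition is void, which is why the limit theorems also assume
  \<open>range g \<subseteq> topspace X\<close>.\<close>

definition pointwise_limit :: "'a topology \<Rightarrow> ('b \<Rightarrow> 'a) filter \<Rightarrow> ('b \<Rightarrow> 'a) \<Rightarrow> bool" where
  "pointwise_limit X F g \<longleftrightarrow> (\<forall>z U. openin X U \<and> g z \<in> U \<longrightarrow> (\<forall>\<^sub>F f in F. f z \<in> U))"

context compact_hermitian_manifold
begin

section \<open>Charts and the metric in coordinates\<close>

lemma chart_open: "c \<in> A \<Longrightarrow> openin X (fst c)"
  using complex_atlas unfolding complex_atlas_def by blast

lemma chart_subset: "c \<in> A \<Longrightarrow> fst c \<subseteq> topspace X"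
  using chart_open openin_subset by blast

lemma chart_exists: "x \<in> topspace X \<Longrightarrow> \<exists>c\<in>A. x \<in> fst c"
  using complex_atlas unfolding complex_atlas_def by blast

lemma chart_homeo:
  "c \<in> A \<Longrightarrow> homeomorphic_map (subtopology X (fst c)) (top_of_set (snd c ` fst c)) (snd c)"
  using complex_atlas unfolding complex_atlas_def by blast

lemma chart_inj: "c \<in> A \<Longrightarrow> inj_on (snd c) (fst c)"
  using homeomorphic_imp_injective_map[OF chart_homeo, of c] chart_subset[of c]
  by (simp add: Int_absorb1)

lemma open_chart_image:
  assumes "c \<in> A" "openin X U" shows "open (snd c ` (fst c \<inter> U))"
proof -
  have "openin (subtopology X (fst c)) (fst c \<inter> U)"
    using assms by (metis openin_subtopology_Int2)
  then have "openin (top_of_set (snd c ` fst c)) (snd c ` (fst c \<inter> U))"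
    using homeomorphic_imp_open_map[OF chart_homeo[OF assms(1)]] unfolding open_map_def by blast
  moreover have "open (snd c ` fst c)"
    using assms complex_atlas unfolding complex_atlas_def by blast
  ultimately show ?thesis
    using openin_open_trans by blast
qed

lemma open_chart_vimage:
  assumes "c \<in> A" "open W" shows "openin X {x \<in> fst c. snd c x \<in> W}"
proof -
  have "continuous_map (subtopology X (fst c)) euclidean (snd c)"
    using homeomorphic_imp_continuous_map[OF chart_homeo[OF assms(1)]] continuous_map_in_subtopology by blast
  then have "openin (subtopology X (fst c)) {x \<in> topspace (subtopology X (fst c)). snd c x \<in> W}"
    by (rule openin_continuous_map_preimage) (use assms in auto)
  moreover have "topspace (subtopology X (fst c)) = fst c"
    using chart_subset[OF assms(1)] by (simp add: Int_absorb1)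
  ultimately show ?thesis
    using openin_trans_full[OF _ chart_open[OF assms(1)]] by (simp only:)
qed

text \<open>The preimage of \<open>K\<close> is compact in \<open>X\<close>, hence closed by the
  Hausdorff property. Such sets keep limits of curves inside a chart.\<close>

lemma closed_chart_vimage:
  assumes c: "c \<in> A" and K: "compact K" "K \<subseteq> snd c ` fst c"
  shows "closedin X {x \<in> fst c. snd c x \<in> K}"
proof -
  let ?S = "{x \<in> fst c. snd c x \<in> K}"
  have im: "snd c ` ?S = K" using K by blast
  have "compactin (top_of_set (snd c ` fst c)) (snd c ` ?S)"
    using K by (simp add: im compactin_subtopology)
  then have "compactin (subtopology X (fst c)) ?S"
    using homeomorphic_map_compactness[OF chart_homeo[OF c], of ?S] chart_subset[OF c]
    by (auto simp: Int_absorb1)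
  then have "compactin X ?S" using compactin_subtopology by blast
  then show ?thesis
    using Hausdorff_space compactin_imp_closedin by blast
qed

lemma continuous_on_metric_coeff:
  "c \<in> A \<Longrightarrow> continuous_on (snd c ` fst c) (\<lambda>p. h c (inv_into (fst c) (snd c) p))"
  using hermitian_metric unfolding hermitian_metric_def smooth_map_on_def
  by (metis Ck_on.simps(1))

lemma chart_inv: "c \<in> A \<Longrightarrow> x \<in> fst c \<Longrightarrow> inv_into (fst c) (snd c) (snd c x) = x"
  by (simp add: chart_inj)

lemma metric_pos: "c \<in> A \<Longrightarrow> x \<in> fst c \<Longrightarrow> v \<noteq> 0 \<Longrightarrow> 0 < Re (hermitian_form (h c x) v v)"
  using hermitian_metric unfolding hermitian_metric_def by blast

lemma metric_nonneg: "c \<in> A \<Longrightarrow> x \<in> fst c \<Longrightarrow> 0 \<le> Re (hermitian_form (h c x) v v)"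
  using metric_pos[of c x v] by (cases "v = 0") (auto simp: hermitian_form_def less_imp_le)

text \<open>The form is continuous and positive on the compact set of pairs of a point of
  \<open>K\<close> and a unit vector, so it has a positive minimum there; homogeneity of degree 2
  extends the bound to all vectors.\<close>

lemma metric_lower_bound:
  assumes c: "c \<in> A" and K: "compact K" "K \<subseteq> snd c ` fst c"
  shows "\<exists>m>0. \<forall>x\<in>fst c. snd c x \<in> K \<longrightarrow> (\<forall>v. m * (norm v)\<^sup>2 \<le> Re (hermitian_form (h c x) v v))"
proof (cases "K = {}")
  case False
  define G where "G = (\<lambda>q. Re (hermitian_form (h c (inv_into (fst c) (snd c) (fst q))) (snd q) (snd q)))"
  have "continuous_on (K \<times> sphere 0 1) (\<lambda>q. h c (inv_into (fst c) (snd c) (fst q)))"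
    by (rule continuous_on_compose2[OF continuous_on_metric_coeff[OF c]]) (use K in \<open>auto intro: continuous_intros\<close>)
  then have cont: "continuous_on (K \<times> sphere 0 1) G"
    unfolding G_def hermitian_form_def by (intro continuous_intros) auto
  have cpt: "compact (K \<times> sphere (0::complex^'n) 1)" using K by (intro compact_Times) auto
  obtain v0 :: "complex^'n" where "norm v0 = 1" using vector_choose_size[of 1] by auto
  then have ne: "K \<times> sphere (0::complex^'n) 1 \<noteq> {}"
    using False by auto
  obtain q where q: "q \<in> K \<times> sphere 0 1" and min: "\<And>q'. q' \<in> K \<times> sphere 0 1 \<Longrightarrow> G q \<le> G q'"
    using continuous_attains_inf[OF cpt ne cont] by metis
  have "fst q \<in> snd c ` fst c" "snd q \<noteq> 0" using q K by auto
  then have "0 < G q"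
    unfolding G_def by (intro metric_pos[OF c] inv_into_into)
  moreover have "G q * (norm v)\<^sup>2 \<le> Re (hermitian_form (h c x) v v)" if x: "x \<in> fst c" "snd c x \<in> K" for x v
  proof (cases "v = 0")
    case False
    define w where "w = complex_of_real (inverse (norm v)) *s v"
    have "norm w = 1" using False by (simp add: w_def norm_vector_scale norm_inverse)
    then have "G q \<le> Re (hermitian_form (h c x) w w)"
      using min[of "(snd c x, w)"] x by (simp add: G_def chart_inv[OF c])
    also have "\<dots> = Re (of_real ((inverse (norm v))\<^sup>2) * hermitian_form (h c x) v v)"
      by (simp add: w_def hermitian_form_scale power2_eq_square)
    also have "\<dots> = Re (hermitian_form (h c x) v v) / (norm v)\<^sup>2"
      by (simp only: times_complex.simps Re_complex_of_real Im_complex_of_real) (simp add: field_simps)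
    finally show ?thesis using False by (simp add: field_simps)
  qed (simp add: metric_nonneg[OF c x(1)])
  ultimately show ?thesis by blast
qed (auto intro: exI[of _ 1])

section \<open>Derivatives of curves and the density in an arbitrary chart\<close>

lemma open_curve_vimage:
  assumes "continuous_map euclidean X f" "openin X U" shows "open {z. f z \<in> U}"
  using openin_continuous_map_preimage[OF assms] by simp

lemma curve_has_field_derivative:
  assumes f: "holomorphic_curve X A f" and c: "c \<in> A" and z: "f z \<in> fst c"
  shows "((\<lambda>w. snd c (f w) $ i) has_field_derivative chart_deriv c f z $ i) (at z)"
proof -
  have "(\<lambda>w. snd c (f w) $ i) holomorphic_on {z. f z \<in> fst c}" "open {z. f z \<in> fst c}"
    using f c open_curve_vimage[OF _ chart_open[OF c]] unfolding holomorphic_curve_def by auto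
  then show ?thesis
    using z by (simp add: chart_deriv_def holomorphic_derivI)
qed

lemma curve_has_derivative:
  assumes f: "holomorphic_curve X A f" and c: "c \<in> A" and z: "f z \<in> fst c"
  shows "((\<lambda>w. snd c (f w)) has_derivative (\<lambda>v. v *s chart_deriv c f z)) (at z)"
proof (subst has_derivative_componentwise_within, intro ballI)
  fix b :: "complex^'n" assume "b \<in> Basis"
  then obtain i b' where b: "b = axis i b'" by (auto simp: Basis_vec_def)
  have "((\<lambda>w. snd c (f w) $ i) has_derivative (\<lambda>v. v * chart_deriv c f z $ i)) (at z)"
    using curve_has_field_derivative[OF assms, of i]
    by (simp add: has_field_derivative_def mult_commute_abs)
  from has_derivative_inner_left[OF this, of b']
  show "((\<lambda>w. snd c (f w) \<bullet> b) has_derivative (\<lambda>v. (v *s chart_deriv c f z) \<bullet> b)) (at z)"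
    by (simp add: b inner_axis)
qed

text \<open>The chart picked by \<open>SOME\<close> can be exchanged for any other: the chain rule
  through the transition map carries one coordinate velocity to the other, and the compatibility of
  the metric equates the two values of the form.\<close>

lemma pullback_density_eq:
  assumes f: "holomorphic_curve X A f" and c: "c \<in> A" and z: "f z \<in> fst c"
  shows "pullback_density A h f z =
    Re (hermitian_form (h c (f z)) (chart_deriv c f z) (chart_deriv c f z))"
proof -
  define c0 where "c0 = (SOME c. c \<in> A \<and> f z \<in> fst c)"
  have c0: "c0 \<in> A" "f z \<in> fst c0"
    using someI[of "\<lambda>c. c \<in> A \<and> f z \<in> fst c" c] c z by (auto simp: c0_def)
  define d0 where "d0 = chart_deriv c0 f z"
  define d where "d = chart_deriv c f z"
  have D0: "((\<lambda>w. snd c0 (f w)) has_derivative (\<lambda>v. v *s d0)) (at z)"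
    unfolding d0_def by (rule curve_has_derivative[OF f c0])
  have "pullback_density A h f z = - Im (hermitian_form (h c0 (f z)) (1 *s d0) (\<i> *s d0))"
    unfolding pullback_density_def c0_def[symmetric] Let_def kaehler_form_def
    using frechet_derivative_at[OF D0] by metis
  \<comment> \<open>The form is conjugate linear in its second argument, so \<open>\<i>\<close>
    comes out as \<open>- \<i>\<close> and minus the imaginary part becomes the real part.\<close>
  also have "\<dots> = Re (hermitian_form (h c0 (f z)) d0 d0)"
    by (simp only: hermitian_form_scale) simp
  also have "\<dots> = Re (hermitian_form (h c (f z)) d d)"
  proof -
    let ?T = "transition c0 c" and ?p = "snd c0 (f z)"
    have "holomorphic_map_on ?T (snd c0 ` (fst c0 \<inter> fst c))"
      using complex_atlas c0 c unfolding complex_atlas_def by blast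
    then obtain DT where DT: "(?T has_derivative DT) (at ?p)"
      using c0 z unfolding holomorphic_map_on_def by blast
    have "((?T \<circ> (\<lambda>w. snd c0 (f w))) has_derivative (DT \<circ> (\<lambda>v. v *s d0))) (at z)"
      by (rule diff_chain_at[OF D0 DT])
    moreover have "((?T \<circ> (\<lambda>w. snd c0 (f w))) has_derivative (\<lambda>v. v *s d)) (at z)"
    proof (rule has_derivative_transform_within_open)
      show "((\<lambda>w. snd c (f w)) has_derivative (\<lambda>v. v *s d)) (at z)"
        unfolding d_def by (rule curve_has_derivative[OF assms])
      show "open {w. f w \<in> fst c0}"
        using f chart_open[OF c0(1)] open_curve_vimage unfolding holomorphic_curve_def by blast
    qed (use c0 in \<open>auto simp: transition_def chart_inv\<close>)
    ultimately have "DT \<circ> (\<lambda>v. v *s d0) = (\<lambda>v. v *s d)"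
      by (rule has_derivative_unique)
    from fun_cong[OF this, of 1] have "frechet_derivative ?T (at ?p) d0 = d"
      using frechet_derivative_at[OF DT] by simp
    moreover have "hermitian_form (h c0 (f z)) d0 d0 =
        hermitian_form (h c (f z)) (frechet_derivative ?T (at ?p) d0) (frechet_derivative ?T (at ?p) d0)"
      using hermitian_metric c0 c z unfolding hermitian_metric_def by blast
    ultimately show ?thesis by simp
  qed
  finally show ?thesis by (simp add: d_def)
qed

abbreviation density :: "(complex \<Rightarrow> 'a) \<Rightarrow> complex \<Rightarrow> real" where
  "density f z \<equiv> pullback_density A h f z"

lemma holomorphic_curve_in: "holomorphic_curve X A f \<Longrightarrow> f z \<in> topspace X"
  unfolding holomorphic_curve_def continuous_map_def by auto

lemma density_nonneg:
  assumes "holomorphic_curve X A f" shows "0 \<le> density f z"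
proof -
  obtain c where "c \<in> A" "f z \<in> fst c" using chart_exists holomorphic_curve_in[OF assms] by blast
  then show ?thesis using pullback_density_eq[OF assms] metric_nonneg by simp
qed

lemma brody_curve_iff:
  "f \<in> brody_curves X A h \<longleftrightarrow> holomorphic_curve X A f \<and> (\<forall>z. density f z \<le> 1)"
  by (auto simp: brody_curves_def spherical_derivative_def)

section \<open>Uniform Lipschitz bounds for Brody curves\<close>

text \<open>Density at most 1 and the lower bound for the metric over \<open>K\<close> bound the
  coordinate speed by \<open>1 / sqrt m\<close> while the curve stays over \<open>K\<close>. At this
  speed a curve starting in \<open>V\<close> cannot leave the larger set \<open>W\<close> within
  distance \<open>d\<close>; none of the constants depends on the curve or on
  \<open>z\<close>.\<close>

lemma brody_curve_lipschitz:
  assumes c: "c \<in> A" and U: "openin X U" and x: "x \<in> fst c" "x \<in> U"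
  obtains V K L d where "openin X V" "x \<in> V" "compact K" "K \<subseteq> snd c ` (fst c \<inter> U)" "0 < L" "0 < d"
    "\<forall>f\<in>brody_curves X A h. \<forall>z. f z \<in> V \<longrightarrow> (\<forall>w\<in>cball z d. f w \<in> fst c \<and> snd c (f w) \<in> K)"
    "\<forall>f\<in>brody_curves X A h. \<forall>z. f z \<in> V \<longrightarrow>
       (\<forall>w\<in>cball z d. \<forall>w'\<in>cball z d. norm (snd c (f w) - snd c (f w')) \<le> L * norm (w - w'))"
proof -
  define p where "p = snd c x"
  have "p \<in> snd c ` (fst c \<inter> U)" using x by (auto simp: p_def)
  then obtain r0 where r0: "0 < r0" "cball p r0 \<subseteq> snd c ` (fst c \<inter> U)"
    using open_chart_image[OF c U] open_contains_cball by blast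
  \<comment> \<open>The radii \<open>r\<close>, \<open>2 * r\<close>, \<open>3 * r\<close> belong to
    \<open>V\<close>, \<open>Q\<close>, \<open>W\<close>: curves start in the first, travel at most
    \<open>L * d = r\<close>, and so remain in the second, strictly inside the third.\<close>
  define r where "r = r0 / 3"
  have r: "0 < r" "r0 = 3 * r" using r0 by (auto simp: r_def)
  define K where "K = cball p r0"
  have K: "compact K" "K \<subseteq> snd c ` fst c" using r0 by (auto simp: K_def)
  obtain m where m: "0 < m" "\<And>y v. y \<in> fst c \<Longrightarrow> snd c y \<in> K \<Longrightarrow> m * (norm v)\<^sup>2 \<le> Re (hermitian_form (h c y) v v)"
    using metric_lower_bound[OF c K] by blast
  define L where "L = 1 / sqrt m"
  define d where "d = r / L"
  have L: "0 < L" "L * d = r" and d: "0 < d" using m r by (auto simp: L_def d_def)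
  define V where "V = {y \<in> fst c. snd c y \<in> ball p r}"
  define W where "W = {y \<in> fst c. snd c y \<in> ball p r0}"
  define Q where "Q = {y \<in> fst c. snd c y \<in> cball p (2 * r)}"
  have opn: "openin X V" "openin X W"
    unfolding V_def W_def by (rule open_chart_vimage[OF c open_ball])+
  have "cball p (2 * r) \<subseteq> K" using r by (auto simp: K_def)
  then have "closedin X Q"
    unfolding Q_def using K by (intro closed_chart_vimage[OF c]) auto
  have lip: "norm (snd c (f w) - snd c (f w')) \<le> L * norm (w - w')"
    if f: "f \<in> brody_curves X A h" and S: "convex S" "\<And>w. w \<in> S \<Longrightarrow> f w \<in> W" and w: "w \<in> S" "w' \<in> S" for f S w w'
  proof (rule differentiable_bound[OF S(1), where f = "\<lambda>w. snd c (f w)" and f' = "\<lambda>y v. v *s chart_deriv c f y"])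
    fix y assume "y \<in> S"
    then have y: "f y \<in> fst c" "snd c (f y) \<in> K" using S(2)[of y] by (auto simp: W_def K_def)
    have hol: "holomorphic_curve X A f" using f by (simp add: brody_curve_iff)
    show "((\<lambda>w. snd c (f w)) has_derivative (\<lambda>v. v *s chart_deriv c f y)) (at y within S)"
      by (rule has_derivative_at_withinI[OF curve_has_derivative[OF hol c y(1)]])
    have "m * (norm (chart_deriv c f y))\<^sup>2 \<le> 1"
      using m(2)[OF y, of "chart_deriv c f y"] f
      by (auto simp: brody_curve_iff pullback_density_eq[OF hol c y(1)] dest!: spec[of _ y])
    then have "(norm (chart_deriv c f y))\<^sup>2 \<le> L\<^sup>2"
      using m(1) by (simp add: L_def power_divide field_simps)
    then have "norm (chart_deriv c f y) \<le> L" using L(1) by (simp add: power2_le_iff_abs_le)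
    then show "onorm (\<lambda>v. v *s chart_deriv c f y) \<le> L"
      by (intro onorm_le) (simp add: norm_vector_scale mult.commute[of L] mult_left_mono)
  qed (use w in auto)
  have stay: "f w \<in> W" if f: "f \<in> brody_curves X A h" and z: "f z \<in> V" and w: "w \<in> cball z d" for f z w
  proof (rule ccontr)
    assume "f w \<notin> W"
    have cont: "continuous_map euclidean X f" using f by (simp add: brody_curve_iff holomorphic_curve_def)
    define S where "S = cball z d \<inter> {w. f w \<notin> W}"
    have "closed {w. f w \<notin> W}"
      using open_curve_vimage[OF cont opn(2)] by (simp add: closed_def Compl_eq)
    then have S: "closed S" "S \<noteq> {}" using w \<open>f w \<notin> W\<close> by (auto simp: S_def)
    obtain w0 where w0: "w0 \<in> S" and min: "\<And>y. y \<in> S \<Longrightarrow> dist z w0 \<le> dist z y"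
      using distance_attains_inf[OF S] by blast
    define \<delta> where "\<delta> = dist z w0"
    \<comment> \<open>\<open>w0\<close> is a nearest point to \<open>z\<close> at which \<open>f\<close> leaves \<open>W\<close>; up to there the Lipschitz bound applies.\<close>
    have in_W: "f y \<in> W" if "y \<in> ball z \<delta>" for y
      using min[of y] that w0 by (auto simp: S_def \<delta>_def not_less)
    have "z \<noteq> w0" using z w0 r by (auto simp: S_def V_def W_def)
    then have \<delta>: "0 < \<delta>" "\<delta> \<le> d" using w0 by (auto simp: \<delta>_def S_def)
    have "f y \<in> Q" if y: "y \<in> ball z \<delta>" for y
    proof -
      have "norm (snd c (f z) - snd c (f y)) \<le> L * norm (z - y)"
        by (rule lip[OF f, of "ball z \<delta>"]) (use y \<delta> in_W in auto)
      also have "\<dots> \<le> L * d" using y \<delta> L by (intro mult_left_mono) (auto simp: dist_norm)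
      finally have "dist (snd c (f z)) (snd c (f y)) \<le> r" using L by (simp add: dist_norm)
      moreover have "dist p (snd c (f z)) < r" using z by (simp add: V_def)
      ultimately show ?thesis
        using in_W[OF y] dist_triangle[of p "snd c (f y)" "snd c (f z)"] by (auto simp: Q_def W_def)
    qed
    \<comment> \<open>The estimate holds on the open ball only; closedness of \<open>Q\<close>
      passes it to the boundary point \<open>w0\<close>, and \<open>2 * r < r0\<close> then puts
      \<open>f w0\<close> into \<open>W\<close>.\<close>
    moreover have "closed {y. f y \<in> Q}"
      using closedin_continuous_map_preimage[OF cont \<open>closedin X Q\<close>] by simp
    ultimately have "closure (ball z \<delta>) \<subseteq> {y. f y \<in> Q}"
      by (intro closure_minimal) auto
    moreover have "w0 \<in> closure (ball z \<delta>)" using \<delta> by (simp add: \<delta>_def)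
    ultimately have "f w0 \<in> W" using r by (auto simp: Q_def W_def)
    with w0 show False by (simp add: S_def)
  qed
  show ?thesis
  proof
    show "x \<in> V" using x r by (simp add: V_def p_def)
    show "\<forall>f\<in>brody_curves X A h. \<forall>z. f z \<in> V \<longrightarrow> (\<forall>w\<in>cball z d. f w \<in> fst c \<and> snd c (f w) \<in> K)"
      using stay by (auto simp: W_def K_def less_imp_le)
    show "\<forall>f\<in>brody_curves X A h. \<forall>z. f z \<in> V \<longrightarrow>
       (\<forall>w\<in>cball z d. \<forall>w'\<in>cball z d. norm (snd c (f w) - snd c (f w')) \<le> L * norm (w - w'))"
      using stay by (intro ballI allI impI lip[of _ "cball z d" for z]) auto
  qed (use opn K r0 L d in \<open>auto simp: K_def\<close>)
qed

lemma chart_image_mem: "c \<in> A \<Longrightarrow> y \<in> fst c \<Longrightarrow> snd c y \<in> snd c ` (fst c \<inter> U) \<Longrightarrow> y \<in> U"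
  using chart_inj[of c] by (auto dest: inj_onD)

text \<open>The Lipschitz bound freed from coordinates: \<open>V\<close> surrounds a point of
  \<open>X\<close>, not of the plane, so one \<open>d\<close> serves all Brody curves at all
  \<open>z\<close> mapped into \<open>V\<close>.\<close>

lemma brody_equicontinuous:
  assumes "openin X U" "x \<in> U"
  obtains V d where "openin X V" "x \<in> V" "0 < d"
    "\<forall>f\<in>brody_curves X A h. \<forall>z. f z \<in> V \<longrightarrow> f ` cball z d \<subseteq> U"
proof -
  obtain c where c: "c \<in> A" "x \<in> fst c" using chart_exists assms openin_subset by blast
  obtain V K L d where V: "openin X V" "x \<in> V" "compact K" "K \<subseteq> snd c ` (fst c \<inter> U)" "0 < L" "0 < d"
    "\<forall>f\<in>brody_curves X A h. \<forall>z. f z \<in> V \<longrightarrow> (\<forall>w\<in>cball z d. f w \<in> fst c \<and> snd c (f w) \<in> K)"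
    "\<forall>f\<in>brody_curves X A h. \<forall>z. f z \<in> V \<longrightarrow>
       (\<forall>w\<in>cball z d. \<forall>w'\<in>cball z d. norm (snd c (f w) - snd c (f w')) \<le> L * norm (w - w'))"
    using brody_curve_lipschitz[OF c(1) assms(1) c(2) assms(2)] by metis
  show ?thesis
    by (rule that[OF V(1,2,6)]) (use V(4,7) chart_image_mem[OF c(1)] in blast)
qed

section \<open>Pointwise limits of Brody curves\<close>

lemma tendsto_chart:
  assumes "c \<in> A" "pointwise_limit X F g" "g z \<in> fst c"
  shows "((\<lambda>f. snd c (f z)) \<longlongrightarrow> snd c (g z)) F"
proof (rule topological_tendstoI)
  fix S assume "open S" "snd c (g z) \<in> S"
  then have "\<forall>\<^sub>F f in F. f z \<in> {y \<in> fst c. snd c y \<in> S}"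
    using assms open_chart_vimage[of c S] unfolding pointwise_limit_def by blast
  then show "\<forall>\<^sub>F f in F. snd c (f z) \<in> S" by (rule eventually_mono) auto
qed

text \<open>Eventually all curves send \<open>z\<close> into the same \<open>V\<close>, so they stay
  over one compact \<open>K\<close> on one disc with one Lipschitz constant, and pointwise
  convergence becomes uniform.\<close>

lemma pointwise_limit_locally_uniform:
  assumes F: "F \<noteq> bot" and B: "\<forall>\<^sub>F f in F. f \<in> brody_curves X A h"
    and lim: "pointwise_limit X F g" and g: "range g \<subseteq> topspace X"
    and c: "c \<in> A" and U: "openin X U" and z: "g z \<in> fst c" "g z \<in> U"
  obtains d where "0 < d" "g ` cball z d \<subseteq> fst c \<inter> U"
    "\<forall>\<^sub>F f in F. \<forall>w\<in>cball z d. f w \<in> fst c"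
    "\<forall>i. uniform_limit (cball z d) (\<lambda>f w. snd c (f w) $ i) (\<lambda>w. snd c (g w) $ i) F"
proof -
  obtain V K L d where V: "openin X V" "g z \<in> V" and K: "compact K" "K \<subseteq> snd c ` (fst c \<inter> U)"
    and pos: "0 < L" "0 < d"
    and stay: "\<forall>f\<in>brody_curves X A h. \<forall>z. f z \<in> V \<longrightarrow> (\<forall>w\<in>cball z d. f w \<in> fst c \<and> snd c (f w) \<in> K)"
    and lip: "\<forall>f\<in>brody_curves X A h. \<forall>z. f z \<in> V \<longrightarrow>
       (\<forall>w\<in>cball z d. \<forall>w'\<in>cball z d. norm (snd c (f w) - snd c (f w')) \<le> L * norm (w - w'))"
    using brody_curve_lipschitz[OF c U z] by metis
  define Q where "Q = {y \<in> fst c. snd c y \<in> K}"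
  have Q: "closedin X Q" unfolding Q_def using K by (intro closed_chart_vimage[OF c]) auto
  have "\<forall>\<^sub>F f in F. f z \<in> V" using lim V unfolding pointwise_limit_def by blast
  with B have ev: "\<forall>\<^sub>F f in F. f \<in> brody_curves X A h \<and> f z \<in> V" by eventually_elim simp
  \<comment> \<open>Values in a closed set persist in the limit, so \<open>g\<close> stays in the
    chart on the whole disc although its continuity is not yet known.\<close>
  have gQ: "g w \<in> Q" if w: "w \<in> cball z d" for w
  proof (rule ccontr)
    assume "g w \<notin> Q"
    then have "\<forall>\<^sub>F f in F. f w \<in> topspace X - Q"
      using lim g Q unfolding pointwise_limit_def by (metis DiffI openin_diff openin_topspace rangeI subsetD)
    with ev have "\<forall>\<^sub>F f in F. False"
      by eventually_elim (use stay w in \<open>auto simp: Q_def\<close>)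
    with F show False by simp
  qed
  have unif: "uniform_limit (cball z d) (\<lambda>f w. snd c (f w)) (\<lambda>w. snd c (g w)) F"
  proof (rule uniform_limit_equi_lipschitz[OF compact_cball less_imp_le[OF pos(1)] F])
    show "\<forall>\<^sub>F f in F. \<forall>x\<in>cball z d. \<forall>y\<in>cball z d. dist (snd c (f x)) (snd c (f y)) \<le> L * dist x y"
      using ev by eventually_elim (use lip in \<open>auto simp: dist_norm\<close>)
    show "((\<lambda>f. snd c (f w)) \<longlongrightarrow> snd c (g w)) F" if "w \<in> cball z d" for w
      using gQ[OF that] by (intro tendsto_chart[OF c lim]) (auto simp: Q_def)
  qed
  show ?thesis
  proof (rule that[OF pos(2)])
    have "g w \<in> fst c \<inter> U" if "w \<in> cball z d" for w
      using gQ[OF that] K(2) chart_image_mem[OF c, of "g w" U] by (auto simp: Q_def)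
    then show "g ` cball z d \<subseteq> fst c \<inter> U" by blast
    show "\<forall>\<^sub>F f in F. \<forall>w\<in>cball z d. f w \<in> fst c"
      using ev by eventually_elim (use stay in blast)
    show "\<forall>i. uniform_limit (cball z d) (\<lambda>f w. snd c (f w) $ i) (\<lambda>w. snd c (g w) $ i) F"
    proof (intro allI uniform_limitI)
      fix i and e :: real assume "0 < e"
      from uniform_limitD[OF unif this]
      show "\<forall>\<^sub>F f in F. \<forall>w\<in>cball z d. dist (snd c (f w) $ i) (snd c (g w) $ i) < e"
        by eventually_elim (meson dist_vec_nth_le le_less_trans)
    qed
  qed
qed

lemma brody_continuous_on_chart:
  assumes "holomorphic_curve X A f" "c \<in> A" "\<And>w. w \<in> S \<Longrightarrow> f w \<in> fst c"
  shows "continuous_on S (\<lambda>w. snd c (f w) $ i)"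
proof (rule continuous_on_subset[OF holomorphic_on_imp_continuous_on])
  show "(\<lambda>w. snd c (f w) $ i) holomorphic_on {z. f z \<in> fst c}"
    using assms unfolding holomorphic_curve_def by blast
qed (use assms in blast)

text \<open>Weierstrass' theorem on uniform limits of holomorphic functions, applied to the
  coordinates on a small disc.\<close>

lemma pointwise_limit_chart_deriv:
  assumes F: "F \<noteq> bot" and B: "\<forall>\<^sub>F f in F. f \<in> brody_curves X A h"
    and lim: "pointwise_limit X F g" and g: "range g \<subseteq> topspace X"
    and c: "c \<in> A" and z: "g z \<in> fst c"
  shows "((\<lambda>w. snd c (g w) $ i) has_field_derivative chart_deriv c g z $ i) (at z)"
    and "((\<lambda>f. chart_deriv c f z $ i) \<longlongrightarrow> chart_deriv c g z $ i) F"
proof -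
  have gz: "g z \<in> topspace X" using g by auto
  obtain d where d: "0 < d" "g ` cball z d \<subseteq> fst c \<inter> topspace X"
    "\<forall>\<^sub>F f in F. \<forall>w\<in>cball z d. f w \<in> fst c"
    "\<forall>i. uniform_limit (cball z d) (\<lambda>f w. snd c (f w) $ i) (\<lambda>w. snd c (g w) $ i) F"
    by (rule pointwise_limit_locally_uniform[OF F B lim g c openin_topspace z gz])
  have "\<forall>\<^sub>F f in F. continuous_on (cball z d) (\<lambda>w. snd c (f w) $ i) \<and>
      (\<forall>w\<in>ball z d. ((\<lambda>w. snd c (f w) $ i) has_field_derivative chart_deriv c f w $ i) (at w))"
    using B d(3)
    by eventually_elim
       (auto simp: brody_curve_iff curve_has_field_derivative[OF _ c] intro!: brody_continuous_on_chart[OF _ c])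
  then have "\<exists>g'. \<forall>w\<in>ball z d. ((\<lambda>w. snd c (g w) $ i) has_field_derivative g' w) (at w)
      \<and> ((\<lambda>f. chart_deriv c f w $ i) \<longlongrightarrow> g' w) F"
    by (rule has_complex_derivative_uniform_limit[OF _ d(4)[rule_format] F d(1)]) blast
  then obtain g' where g': "\<And>w. w \<in> ball z d \<Longrightarrow> ((\<lambda>w. snd c (g w) $ i) has_field_derivative g' w) (at w)
      \<and> ((\<lambda>f. chart_deriv c f w $ i) \<longlongrightarrow> g' w) F" by blast
  have "z \<in> ball z d" using d by simp
  from DERIV_imp_deriv[OF conjunct1[OF g'[OF this]]] have "g' z = chart_deriv c g z $ i"
    by (simp add: chart_deriv_def)
  with g'[OF \<open>z \<in> ball z d\<close>] show
    "((\<lambda>w. snd c (g w) $ i) has_field_derivative chart_deriv c g z $ i) (at z)"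
    "((\<lambda>f. chart_deriv c f z $ i) \<longlongrightarrow> chart_deriv c g z $ i) F" by auto
qed

text \<open>In a chart around \<open>g z\<close> the density is a continuous expression in the
  metric coefficients at \<open>f z\<close> and the chart derivatives, all of which converge. The
  bound by 1 passes to the limit.\<close>

proposition pointwise_limit_brody:
  assumes F: "F \<noteq> bot" and B: "\<forall>\<^sub>F f in F. f \<in> brody_curves X A h"
    and lim: "pointwise_limit X F g" and g: "range g \<subseteq> topspace X"
  shows "g \<in> brody_curves X A h" and "((\<lambda>f. density f z) \<longlongrightarrow> density g z) F"
proof -
  have "continuous_map euclidean X g"
    unfolding continuous_map_def
  proof (intro conjI allI impI)
    fix U assume U: "openin X U"
    have "\<exists>d>0. ball z d \<subseteq> {z. g z \<in> U}" if z: "g z \<in> U" for z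
    proof -
      obtain c where c: "c \<in> A" "g z \<in> fst c" using chart_exists g by blast
      obtain d where d: "0 < d" "g ` cball z d \<subseteq> fst c \<inter> U"
        by (rule pointwise_limit_locally_uniform[OF F B lim g c(1) U c(2) z])
      then have "ball z d \<subseteq> {z. g z \<in> U}" using ball_subset_cball by blast
      with d(1) show ?thesis by blast
    qed
    then show "openin euclidean {x \<in> topspace euclidean. g x \<in> U}"
      by (auto simp: open_contains_ball)
  qed (use g in auto)
  then have hol: "holomorphic_curve X A g"
    unfolding holomorphic_curve_def holomorphic_on_def field_differentiable_def
    using has_field_derivative_at_within[OF pointwise_limit_chart_deriv(1)[OF F B lim g]] by fast
  have conv: "((\<lambda>f. density f z) \<longlongrightarrow> density g z) F" for z
  proof -
    obtain c where c: "c \<in> A" "g z \<in> fst c" using chart_exists g by blast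
    have "continuous_on (snd c ` (fst c \<inter> topspace X)) (\<lambda>p. h c (inv_into (fst c) (snd c) p))"
      using continuous_on_metric_coeff[OF c(1)] by (rule continuous_on_subset) auto
    then have "isCont (\<lambda>p. h c (inv_into (fst c) (snd c) p)) (snd c (g z))"
      using open_chart_image[OF c(1) openin_topspace] c g
      by (auto simp: continuous_on_eq_continuous_at)
    then have "((\<lambda>f. h c (inv_into (fst c) (snd c) (snd c (f z)))) \<longlongrightarrow>
        h c (inv_into (fst c) (snd c) (snd c (g z)))) F"
      by (rule isCont_tendsto_compose) (rule tendsto_chart[OF c(1) lim c(2)])
    then have "((\<lambda>f. Re (hermitian_form (h c (inv_into (fst c) (snd c) (snd c (f z)))) (chart_deriv c f z) (chart_deriv c f z)))
        \<longlongrightarrow> Re (hermitian_form (h c (inv_into (fst c) (snd c) (snd c (g z)))) (chart_deriv c g z) (chart_deriv c g z))) F"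
      unfolding hermitian_form_def
      by (intro tendsto_intros pointwise_limit_chart_deriv(2)[OF F B lim g c])
    moreover have "\<forall>\<^sub>F f in F. f z \<in> fst c"
      using lim chart_open[OF c(1)] c(2) unfolding pointwise_limit_def by blast
    with B have "\<forall>\<^sub>F f in F. Re (hermitian_form (h c (inv_into (fst c) (snd c) (snd c (f z)))) (chart_deriv c f z) (chart_deriv c f z)) = density f z"
      by eventually_elim (use c in \<open>simp add: brody_curve_iff pullback_density_eq[OF _ c(1)] chart_inv\<close>)
    ultimately show ?thesis
      using c hol by (simp add: pullback_density_eq[OF _ c(1)] chart_inv tendsto_cong)
  qed
  then show "((\<lambda>f. density f z) \<longlongrightarrow> density g z) F" .
  have "density g z \<le> 1" for z
    by (rule tendsto_upperbound[OF conv _ F], rule eventually_mono[OF B]) (simp add: brody_curve_iff)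
  with hol show "g \<in> brody_curves X A h" by (simp add: brody_curve_iff)
qed

section \<open>The space of Brody curves\<close>

abbreviation curve_space :: "(complex \<Rightarrow> 'a) topology" where
  "curve_space \<equiv> product_topology (\<lambda>_. X) UNIV"

abbreviation brody :: "(complex \<Rightarrow> 'a) set" where
  "brody \<equiv> brody_curves X A h"

text \<open>Filters take the place of sequences because the uncountable product need not be first
  countable. The point \<open>g\<close> may lie outside \<open>brody\<close>, as it must in the
  proof that \<open>brody\<close> is closed.\<close>

definition brody_nhds :: "(complex \<Rightarrow> 'a) \<Rightarrow> (complex \<Rightarrow> 'a) filter" where
  "brody_nhds g = inf (nhdsin curve_space g) (principal brody)"

lemma mem_curve_space: "f \<in> topspace curve_space \<longleftrightarrow> range f \<subseteq> topspace X"
  by (auto simp: topspace_product_topology PiE_UNIV_domain)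

lemma brody_subset: "brody \<subseteq> topspace curve_space"
  using holomorphic_curve_in by (auto simp: mem_curve_space brody_curve_iff simp del: topspace_product_topology)

lemma eventually_brody_nhds:
  assumes "g \<in> topspace curve_space"
  shows "eventually P (brody_nhds g) \<longleftrightarrow> (\<exists>S. openin curve_space S \<and> g \<in> S \<and> (\<forall>f\<in>S \<inter> brody. P f))"
  unfolding brody_nhds_def eventually_inf_principal eventually_nhdsin using assms by blast

lemma eventually_in_brody: "\<forall>\<^sub>F f in brody_nhds g. f \<in> brody"
  by (simp add: brody_nhds_def eventually_inf_principal)

lemma brody_nhds_neq_bot:
  assumes "g \<in> brody" shows "brody_nhds g \<noteq> bot"
proof -
  have "g \<in> topspace curve_space" using assms brody_subset by blast
  then show ?thesis
    unfolding trivial_limit_def eventually_brody_nhds[OF \<open>g \<in> topspace curve_space\<close>] using assms by blast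
qed

lemma pointwise_limit_brody_nhds:
  assumes g: "g \<in> topspace curve_space" shows "pointwise_limit X (brody_nhds g) g"
  unfolding pointwise_limit_def
proof (intro allI impI)
  fix z U assume "openin X U \<and> g z \<in> U"
  then show "\<forall>\<^sub>F f in brody_nhds g. f z \<in> U"
    unfolding eventually_brody_nhds[OF g] using g
    by (intro exI[of _ "{f \<in> topspace curve_space. f z \<in> U}"] conjI
        openin_continuous_map_preimage[OF continuous_map_product_projection]) auto
qed

lemma closedin_brody: "closedin curve_space brody"
proof -
  have "curve_space closure_of brody \<subseteq> brody"
  proof
    fix g assume g: "g \<in> curve_space closure_of brody"
    then have gt: "g \<in> topspace curve_space" by (meson closure_of_subset_topspace subsetD)
    have "brody_nhds g \<noteq> bot"
      using g by (auto simp: trivial_limit_def eventually_brody_nhds[OF gt] in_closure_of)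
    then show "g \<in> brody"
      by (rule pointwise_limit_brody(1)[OF _ eventually_in_brody pointwise_limit_brody_nhds[OF gt]])
         (use gt mem_curve_space in blast)
  qed
  then show ?thesis using brody_subset closure_of_subset_eq by blast
qed

lemma openin_brodyI:
  assumes "S \<subseteq> brody" and ev: "\<And>g. g \<in> S \<Longrightarrow> \<forall>\<^sub>F f in brody_nhds g. f \<in> S"
  shows "openin (subtopology curve_space brody) S"
proof (subst openin_subopen, intro ballI)
  fix g assume g: "g \<in> S"
  then have "g \<in> topspace curve_space" using assms(1) brody_subset by blast
  from ev[OF g] obtain W where W: "openin curve_space W" "g \<in> W" "\<forall>f\<in>W \<inter> brody. f \<in> S"
    unfolding eventually_brody_nhds[OF \<open>g \<in> topspace curve_space\<close>] by blast
  then show "\<exists>T. openin (subtopology curve_space brody) T \<and> g \<in> T \<and> T \<subseteq> S"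
    using g assms(1) by (intro exI[of _ "W \<inter> brody"]) (auto simp: openin_subtopology)
qed

text \<open>By equicontinuity a condition \<open>f z \<in> V\<close> at one point controls
  \<open>f\<close> on a disc about \<open>z\<close>; finitely many such conditions control all of
  \<open>K\<close>.\<close>

lemma eventually_compact_into_open:
  assumes g: "g \<in> brody" and K: "compact K" and U: "openin X U" "g ` K \<subseteq> U"
  shows "\<forall>\<^sub>F f in brody_nhds g. f ` K \<subseteq> U"
proof -
  have gt: "g \<in> topspace curve_space" using g brody_subset by blast
  have "\<exists>d>0. \<forall>\<^sub>F f in brody_nhds g. f ` ball z d \<subseteq> U" if z: "z \<in> K" for z
  proof -
    have "g z \<in> U" using z U by blast
    then obtain V d where V: "openin X V" "g z \<in> V" "0 < d"
      "\<forall>f\<in>brody. \<forall>z. f z \<in> V \<longrightarrow> f ` cball z d \<subseteq> U"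
      by (rule brody_equicontinuous[OF U(1)])
    have "\<forall>\<^sub>F f in brody_nhds g. f z \<in> V"
      using pointwise_limit_brody_nhds[OF gt] V unfolding pointwise_limit_def by blast
    with eventually_in_brody[of g] have "\<forall>\<^sub>F f in brody_nhds g. f ` ball z d \<subseteq> U"
      by eventually_elim (use V(4) ball_subset_cball in blast)
    then show ?thesis using V(3) by blast
  qed
  then obtain d where d: "\<And>z. z \<in> K \<Longrightarrow> 0 < d z \<and> (\<forall>\<^sub>F f in brody_nhds g. f ` ball z (d z) \<subseteq> U)"
    by metis
  have "K \<subseteq> (\<Union>z\<in>K. ball z (d z))" using d by force
  then obtain T where T: "T \<subseteq> K" "finite T" "K \<subseteq> (\<Union>z\<in>T. ball z (d z))"
    using compactE_image[OF K, of K "\<lambda>z. ball z (d z)"] by blast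
  have "\<forall>\<^sub>F f in brody_nhds g. \<forall>z\<in>T. f ` ball z (d z) \<subseteq> U"
    using T d by (intro eventually_ball_finite) auto
  then show ?thesis
    by eventually_elim (use T(3) in blast)
qed

text \<open>The identity is continuous in both directions: compact-open conditions persist near
  \<open>g\<close> by equicontinuity, and a condition on the value at \<open>z\<close> is the
  compact-open condition for \<open>K = {z}\<close>.\<close>

lemma brody_space_eq: "brody_space X A h = subtopology curve_space brody"
proof -
  define S where "S = {{f. continuous_map euclidean X f \<and> f ` K \<subseteq> U} | (K::complex set) U. compact K \<and> openin X U}"
  have cont: "continuous_map euclidean X f" if "f \<in> brody" for f
    using that by (simp add: brody_curve_iff holomorphic_curve_def)
  \<comment> \<open>The empty compact set imposes no condition, so this one set contains every
    continuous map.\<close>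
  have "{f. continuous_map euclidean X f \<and> f ` {} \<subseteq> {}} \<in> S" unfolding S_def by blast
  then have sub: "brody \<subseteq> \<Union>S" using cont by blast
  have top1: "topspace (brody_space X A h) = brody"
    using sub by (auto simp: brody_space_def compact_open_topology_def S_def)
  have top2: "topspace (subtopology curve_space brody) = brody"
    using brody_subset by (simp only: topspace_subtopology) blast
  have "continuous_map (subtopology curve_space brody) (topology_generated_by S) (\<lambda>f. f)"
    unfolding continuous_on_generated_topo_iff top2
  proof (intro conjI allI impI)
    fix U' assume "U' \<in> S"
    then obtain K U where K: "compact K" "openin X U"
      and U': "U' = {f. continuous_map euclidean X f \<and> f ` K \<subseteq> U}" unfolding S_def by blast
    show "openin (subtopology curve_space brody) ((\<lambda>f. f) -` U' \<inter> brody)"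
    proof (rule openin_brodyI)
      fix g assume "g \<in> (\<lambda>f. f) -` U' \<inter> brody"
      then have "\<forall>\<^sub>F f in brody_nhds g. f ` K \<subseteq> U"
        using eventually_compact_into_open[OF _ K(1) K(2)] by (auto simp: U')
      with eventually_in_brody[of g] show "\<forall>\<^sub>F f in brody_nhds g. f \<in> (\<lambda>f. f) -` U' \<inter> brody"
        by eventually_elim (use cont in \<open>auto simp: U'\<close>)
    qed auto
  qed (use sub in auto)
  then have 1: "continuous_map (subtopology curve_space brody) (brody_space X A h) (\<lambda>f. f)"
    unfolding brody_space_def compact_open_topology_def S_def[symmetric]
    by (simp add: continuous_map_in_subtopology)
  have "continuous_map (brody_space X A h) curve_space (\<lambda>f. f)"
    unfolding continuous_map_componentwise_UNIV
  proof
    fix z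
    show "continuous_map (brody_space X A h) X (\<lambda>f. f z)"
      unfolding continuous_map_def top1
    proof (intro conjI allI impI)
      fix U assume U: "openin X U"
      have "{f. continuous_map euclidean X f \<and> f ` {z} \<subseteq> U} \<in> S"
        unfolding S_def mem_Collect_eq using U by (intro exI[of _ "{z}"] exI[of _ U]) simp
      then have "openin (topology_generated_by S) {f. continuous_map euclidean X f \<and> f ` {z} \<subseteq> U}"
        by (rule topology_generated_by_Basis)
      then have "openin (brody_space X A h) ({f. continuous_map euclidean X f \<and> f ` {z} \<subseteq> U} \<inter> brody)"
        unfolding brody_space_def compact_open_topology_def S_def[symmetric] openin_subtopology by blast
      moreover have "{f. continuous_map euclidean X f \<and> f ` {z} \<subseteq> U} \<inter> brody = {f \<in> brody. f z \<in> U}"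
        using cont by auto
      ultimately show "openin (brody_space X A h) {f \<in> brody. f z \<in> U}" by simp
    qed (use holomorphic_curve_in brody_curve_iff in auto)
  qed
  then have 2: "continuous_map (brody_space X A h) (subtopology curve_space brody) (\<lambda>f. f)"
    by (simp add: continuous_map_in_subtopology top1)
  show ?thesis
    unfolding topology_eq
  proof
    fix W
    show "openin (brody_space X A h) W \<longleftrightarrow> openin (subtopology curve_space brody) W"
    proof
      assume W: "openin (brody_space X A h) W"
      then have "W \<subseteq> brody" using openin_subset top1 by blast
      then have "{f \<in> brody. f \<in> W} = W" by blast
      then show "openin (subtopology curve_space brody) W"
        using openin_continuous_map_preimage[OF 1 W] by (simp only: top2)
    next
      assume W: "openin (subtopology curve_space brody) W"
      then have "W \<subseteq> brody" using openin_subset top2 by blast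
      then have "{f \<in> brody. f \<in> W} = W" by blast
      then show "openin (brody_space X A h) W"
        using openin_continuous_map_preimage[OF 2 W] by (simp only: top1)
    qed
  qed
qed

lemma topspace_brody_space: "topspace (brody_space X A h) = brody"
  using brody_subset unfolding brody_space_eq by (simp only: topspace_subtopology) blast

proposition compact_brody_space: "compact_space (brody_space X A h)"
proof -
  have "compact_space curve_space"
    using compact_space by (simp add: compact_space_product_topology)
  then have "compactin curve_space brody"
    using closedin_brody closedin_compact_space by blast
  then show ?thesis
    unfolding brody_space_eq by (simp add: compactin_subspace)
qed

section \<open>Closed conditions, translations and continuity of disc integrals\<close>

lemma closedin_level_set:
  fixes \<phi> :: "(complex \<Rightarrow> 'a) \<Rightarrow> real"
  assumes "\<And>g. g \<in> brody \<Longrightarrow> (\<phi> \<longlongrightarrow> \<phi> g) (brody_nhds g)" and C: "closed C"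
  shows "closedin (brody_space X A h) {f \<in> brody. \<phi> f \<in> C}"
proof -
  have "openin (brody_space X A h) {f \<in> brody. \<phi> f \<in> - C}"
    unfolding brody_space_eq
  proof (rule openin_brodyI)
    fix g assume g: "g \<in> {f \<in> brody. \<phi> f \<in> - C}"
    then have "\<forall>\<^sub>F f in brody_nhds g. \<phi> f \<in> - C"
      using assms(1) C by (intro topological_tendstoD[of \<phi> "\<phi> g"]) auto
    with eventually_in_brody[of g] show "\<forall>\<^sub>F f in brody_nhds g. f \<in> {f \<in> brody. \<phi> f \<in> - C}"
      by eventually_elim simp
  qed auto
  moreover have "topspace (brody_space X A h) - {f \<in> brody. \<phi> f \<in> C} = {f \<in> brody. \<phi> f \<in> - C}"
    using topspace_brody_space by auto
  ultimately show ?thesis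
    unfolding closedin_def using topspace_brody_space by auto
qed

lemma translate_brody:
  assumes f: "f \<in> brody" shows "translate a f \<in> brody" "density (translate a f) z = density f (z + a)"
proof -
  have hol: "holomorphic_curve X A f" using f by (simp add: brody_curve_iff)
  have d: "((\<lambda>w. snd c (translate a f w) $ i) has_field_derivative chart_deriv c f (z + a) $ i) (at z)"
    if "c \<in> A" "f (z + a) \<in> fst c" for c i z
    using curve_has_field_derivative[OF hol that, of i] by (simp add: translate_def DERIV_shift)
  have "continuous_map euclidean X (f \<circ> (\<lambda>z. z + a))"
    using hol unfolding holomorphic_curve_def
    by (intro continuous_map_compose[of _ euclidean]) (auto intro!: continuous_intros)
  then have "continuous_map euclidean X (translate a f)"
    by (simp add: translate_def comp_def)
  moreover have "(\<lambda>z. snd c (translate a f z) $ i) holomorphic_on {z. translate a f z \<in> fst c}" if "c \<in> A" for c i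
    unfolding holomorphic_on_def field_differentiable_def
    using has_field_derivative_at_within[OF d[OF that]] unfolding translate_def by fast
  ultimately have hol': "holomorphic_curve X A (translate a f)"
    unfolding holomorphic_curve_def by blast
  show eq: "density (translate a f) z = density f (z + a)" for z
  proof -
    obtain c where c: "c \<in> A" "f (z + a) \<in> fst c"
      using chart_exists holomorphic_curve_in[OF hol] by blast
    then have "chart_deriv c (translate a f) z = chart_deriv c f (z + a)"
      using d[OF c] by (simp add: chart_deriv_def[of c "translate a f"] vec_eq_iff DERIV_imp_deriv)
    then show ?thesis
      using c pullback_density_eq[OF hol c] pullback_density_eq[OF hol' c(1), of z] by (simp add: translate_def)
  qed
  show "translate a f \<in> brody"
    using f hol' eq by (simp add: brody_curve_iff)
qed

text \<open>
  Locally uniform convergence of the densities comes for free from pointwise convergence at \<open>0\<close>, since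
  \<open>density f w\<close> is the density of \<open>translate w f\<close> at \<open>0\<close> and translates depend continuously on \<open>(f, w)\<close>.
\<close>

lemma density_tendsto_joint:
  assumes g: "g \<in> brody"
  shows "((\<lambda>(f, w). density f w) \<longlongrightarrow> density g z) (brody_nhds g \<times>\<^sub>F nhds z)"
proof -
  have gt: "g \<in> topspace curve_space" using g brody_subset by blast
  \<comment> \<open>The joint filter is pushed forward along translation, so the limit theorem for
    Brody curves has to be applied at the point 0 only.\<close>
  let ?G = "filtermap (\<lambda>(f, w). translate w f) (brody_nhds g \<times>\<^sub>F nhds z)"
  have ev: "\<forall>\<^sub>F p in brody_nhds g \<times>\<^sub>F nhds z. fst p \<in> brody"
    using eventually_in_brody[of g] unfolding eventually_prod_filter
    by (intro exI[of _ "\<lambda>f. f \<in> brody"] exI[of _ "\<lambda>_. True"]) auto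
  have "((\<lambda>f. density f 0) \<longlongrightarrow> density (translate z g) 0) ?G"
  proof (rule pointwise_limit_brody(2))
    show "?G \<noteq> bot"
      using brody_nhds_neq_bot[OF g] by (simp add: filtermap_bot_iff prod_filter_eq_bot)
    show "\<forall>\<^sub>F f in ?G. f \<in> brody"
      unfolding eventually_filtermap using ev by eventually_elim (auto intro: translate_brody(1))
    show "range (translate z g) \<subseteq> topspace X"
      using gt unfolding mem_curve_space translate_def by blast
    show "pointwise_limit X ?G (translate z g)"
      unfolding pointwise_limit_def eventually_filtermap
    proof (intro allI impI)
      fix y U assume U: "openin X U \<and> translate z g y \<in> U"
      then have "g (y + z) \<in> U" by (simp add: translate_def)
      \<comment> \<open>\<open>V\<close> absorbs the change of curve, and the disc of radius
        \<open>d\<close> the change of translation parameter.\<close>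
      then obtain V d where V: "openin X V" "g (y + z) \<in> V" "0 < d"
        "\<forall>f\<in>brody. \<forall>z. f z \<in> V \<longrightarrow> f ` cball z d \<subseteq> U"
        using brody_equicontinuous[of U "g (y + z)"] U by metis
      have "\<forall>\<^sub>F f in brody_nhds g. f (y + z) \<in> V"
        using pointwise_limit_brody_nhds[OF gt] V unfolding pointwise_limit_def by blast
      with eventually_in_brody[of g] have "\<forall>\<^sub>F f in brody_nhds g. f \<in> brody \<and> f (y + z) \<in> V"
        by eventually_elim simp
      moreover have "\<forall>\<^sub>F w in nhds z. w \<in> ball z d"
        using V(3) by (intro eventually_nhds_in_open) auto
      ultimately have "\<forall>\<^sub>F p in brody_nhds g \<times>\<^sub>F nhds z. (fst p \<in> brody \<and> fst p (y + z) \<in> V) \<and> snd p \<in> ball z d"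
        by (rule eventually_prodI)
      then show "\<forall>\<^sub>F p in brody_nhds g \<times>\<^sub>F nhds z. (case p of (f, w) \<Rightarrow> translate w f) y \<in> U"
      proof eventually_elim
        case (elim p)
        have "y + snd p \<in> cball (y + z) d" using elim by (simp add: dist_norm)
        then show ?case using elim V(4) by (auto simp: translate_def case_prod_beta' image_subset_iff)
      qed
    qed
  qed
  then have "((\<lambda>p. density (translate (snd p) (fst p)) 0) \<longlongrightarrow> density g z) (brody_nhds g \<times>\<^sub>F nhds z)"
    by (simp add: filterlim_filtermap case_prod_beta' translate_brody(2)[OF g])
  moreover have "\<forall>\<^sub>F p in brody_nhds g \<times>\<^sub>F nhds z.
      density (translate (snd p) (fst p)) 0 = (case p of (f, w) \<Rightarrow> density f w)"
    using ev by eventually_elim (auto simp: translate_brody(2))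
  ultimately show ?thesis
    by (rule Lim_transform_eventually)
qed

lemma continuous_density:
  assumes g: "g \<in> brody" shows "continuous_on UNIV (density g)"
proof -
  have gt: "g \<in> topspace curve_space" using g brody_subset by blast
  have "isCont (density g) z" for z
    unfolding continuous_at tendsto_at_iff_tendsto_nhds
  proof (rule topological_tendstoI)
    fix S assume "open S" "density g z \<in> S"
    from topological_tendstoD[OF density_tendsto_joint[OF g] this]
    obtain P Q where P: "eventually P (brody_nhds g)" and Q: "eventually Q (nhds z)"
      and PQ: "\<And>f w. P f \<Longrightarrow> Q w \<Longrightarrow> density f w \<in> S"
      unfolding eventually_prod_filter by auto
    \<comment> \<open>A Brody curve lies in each of its neighbourhoods, so the joint statement may
      be frozen at \<open>f = g\<close>.\<close>
    have "P g" using P g unfolding eventually_brody_nhds[OF gt] by blast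
    with Q PQ show "\<forall>\<^sub>F w in nhds z. density g w \<in> S"
      by (auto elim: eventually_mono)
  qed
  then show ?thesis by (simp add: continuous_on_eq_continuous_at)
qed

lemma plane_density_brody:
  assumes f: "f \<in> brody" shows "plane_density (density f)"
proof
  show "density f \<in> borel_measurable borel"
    by (rule borel_measurable_continuous_onI[OF continuous_density[OF f]])
  show "0 \<le> density f z" "density f z \<le> 1" for z
    using f density_nonneg[of f z] unfolding brody_curve_iff by blast+
qed

text \<open>Joint convergence gives closeness on a neighbourhood of each point of the plane, and
  finitely many of these cover the disc.\<close>

lemma eventually_density_close:
  assumes g: "g \<in> brody" and e: "0 < e"
  shows "\<forall>\<^sub>F f in brody_nhds g. \<forall>w\<in>cball a r. \<bar>density f w - density g w\<bar> < e"
proof -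
  have "\<exists>S. open S \<and> z \<in> S \<and> (\<forall>\<^sub>F f in brody_nhds g. \<forall>w\<in>S. \<bar>density f w - density g w\<bar> < e)" for z
  proof -
    have "isCont (density g) z"
      using continuous_density[OF g] by (simp add: continuous_on_eq_continuous_at)
    then have "((\<lambda>p. density g (snd p)) \<longlongrightarrow> density g z) (brody_nhds g \<times>\<^sub>F nhds z)"
      unfolding continuous_at tendsto_at_iff_tendsto_nhds by (rule filterlim_compose) (rule filterlim_snd)
    from tendsto_diff[OF density_tendsto_joint[OF g] this]
    have "((\<lambda>(f, w). density f w - density g w) \<longlongrightarrow> 0) (brody_nhds g \<times>\<^sub>F nhds z)"
      by (simp add: case_prod_beta')
    from tendstoD[OF this e] obtain P Q where P: "eventually P (brody_nhds g)" and Q: "eventually Q (nhds z)"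
      and PQ: "\<And>f w. P f \<Longrightarrow> Q w \<Longrightarrow> \<bar>density f w - density g w\<bar> < e"
      unfolding eventually_prod_filter by auto
    from Q obtain S where "open S" "z \<in> S" "\<forall>w\<in>S. Q w" unfolding eventually_nhds by blast
    moreover from P have "\<forall>\<^sub>F f in brody_nhds g. \<forall>w\<in>S. \<bar>density f w - density g w\<bar> < e"
      by (rule eventually_mono) (use PQ \<open>\<forall>w\<in>S. Q w\<close> in blast)
    ultimately show ?thesis by blast
  qed
  then have "\<exists>S. \<forall>z. open (S z) \<and> z \<in> S z \<and>
      (\<forall>\<^sub>F f in brody_nhds g. \<forall>w\<in>S z. \<bar>density f w - density g w\<bar> < e)"
    by (intro choice allI)
  then obtain S where S: "\<And>z. open (S z)" "\<And>z. z \<in> S z"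
      "\<And>z. \<forall>\<^sub>F f in brody_nhds g. \<forall>w\<in>S z. \<bar>density f w - density g w\<bar> < e" by blast
  have "cball a r \<subseteq> (\<Union>z\<in>cball a r. S z)" using S(2) by blast
  then obtain T where T: "T \<subseteq> cball a r" "finite T" "cball a r \<subseteq> (\<Union>z\<in>T. S z)"
    by (rule compactE_image[OF compact_cball S(1)])
  have "\<forall>\<^sub>F f in brody_nhds g. \<forall>z\<in>T. \<forall>w\<in>S z. \<bar>density f w - density g w\<bar> < e"
    by (intro eventually_ball_finite T(2) ballI S(3))
  then show ?thesis
    by eventually_elim (use T(3) in blast)
qed

lemma disc_integral_tendsto:
  assumes g: "g \<in> brody" and r: "0 < r"
  shows "((\<lambda>f. disc_integral (density f) a r) \<longlongrightarrow> disc_integral (density g) a r) (brody_nhds g)"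
proof (rule tendstoI)
  fix e :: real assume e: "0 < e"
  define d where "d = e / (2 * pi * r\<^sup>2)"
  have d: "0 < d" using e r by (simp add: d_def)
  have close: "disc_integral (density f) a r \<le> disc_integral (density f') a r + e / 2"
    if "f \<in> brody" "f' \<in> brody" and lt: "\<forall>w\<in>cball a r. \<bar>density f w - density f' w\<bar> < d" for f f'
  proof -
    interpret f: plane_density "density f" using that plane_density_brody by blast
    interpret f': plane_density "density f'" using that plane_density_brody by blast
    have int_d: "set_integrable lborel (ball a r) (\<lambda>_. d)"
      by (rule f.set_integrable_bounded[where C = "\<bar>d\<bar>"]) auto
    have "density f z \<le> density f' z + d" if "z \<in> ball a r" for z
      using bspec[OF lt, of z] that by auto
    then have "disc_integral (density f) a r \<le> (LINT z:ball a r|lborel. density f' z + d)"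
      unfolding disc_integral_def
      by (intro set_integral_mono f.set_integrable_u set_integral_add(1) f'.set_integrable_u int_d)
    also have "\<dots> = disc_integral (density f') a r + (LINT z:ball a r|lborel. d)"
      unfolding disc_integral_def by (intro set_integral_add(2) f'.set_integrable_u int_d)
    also have "(LINT z:ball a r|lborel. d) = e / 2"
      using r by (simp add: set_lebesgue_integral_def measure_disc d_def)
    finally show ?thesis .
  qed
  from eventually_density_close[OF g d, of a r] eventually_in_brody[of g]
  show "\<forall>\<^sub>F f in brody_nhds g. dist (disc_integral (density f) a r) (disc_integral (density g) a r) < e"
  proof eventually_elim
    case (elim f)
    then show ?case
      using close[of f g] close[of g f] g e by (auto simp: dist_real_def abs_minus_commute)
  qed
qed

lemma closedin_disc_integral:
  assumes "0 < r" "closed C"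
  shows "closedin (brody_space X A h) {f \<in> brody. disc_integral (density f) a r \<in> C}"
  by (rule closedin_level_set[OF disc_integral_tendsto assms(2)]) (use assms(1) in simp_all)

section \<open>Comparison of the densities\<close>

lemma energy_eq:
  assumes f: "f \<in> brody"
  shows "energy A h f a r = ennreal (disc_integral (density f) a r)"
proof -
  have "0 \<le> density f z" for z
    using f density_nonneg unfolding brody_curve_iff by blast
  then have "(spherical_derivative A h f z)\<^sup>2 = density f z" for z
    by (simp add: spherical_derivative_def)
  then show ?thesis
    by (simp only: energy_def plane_density.nn_disc_integral[OF plane_density_brody[OF f]])
qed

lemma energy_density_eq: "f \<in> brody \<Longrightarrow> energy_density A h f = ennreal (disc_density (density f))"
  using plane_density.Lim_SUP_disc_integral[OF plane_density_brody, of f]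
  by (simp add: energy_density_def energy_eq)

lemma NSA_characteristic_eq:
  "f \<in> brody \<Longrightarrow> NSA_characteristic A h r f = plane_density.char_fun (density f) r"
  by (simp add: NSA_characteristic_def energy_eq plane_density.char_fun_def[OF plane_density_brody])

lemma upper_NSA_density_le: "f \<in> brody \<Longrightarrow> upper_NSA_density A h f \<le> energy_density A h f"
  using plane_density.Limsup_char_fun_le[OF plane_density_brody, of f]
  by (simp add: upper_NSA_density_def NSA_characteristic_eq energy_density_eq)

lemma lower_NSA_density_le: "lower_NSA_density A h f \<le> upper_NSA_density A h f"
  unfolding lower_NSA_density_def upper_NSA_density_def by (rule Liminf_le_Limsup) simp

text \<open>A good centre for radii up to \<open>R\<close> becomes a translate of \<open>f\<close>
  that is good at 0, and compactness yields one curve of \<open>N\<close> good at 0 for all radii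
  from \<open>r0\<close> on. A closed set containing the orbit covers both the orbit closure and
  invariant closed sets.\<close>

proposition energy_density_le_SUP_lower_NSA_density:
  assumes N: "closedin (brody_space X A h) N" and f: "\<And>a. translate a f \<in> N"
  shows "energy_density A h f \<le> (SUP g\<in>N. lower_NSA_density A h g)"
proof -
  have NB: "N \<subseteq> brody" using closedin_subset[OF N] topspace_brody_space by simp
  have "translate 0 f = f" by (simp add: translate_def)
  then have fB: "f \<in> brody" using NB f[of 0] by auto
  interpret f: plane_density "density f" by (rule plane_density_brody[OF fB])
  define \<rho> where "\<rho> = disc_density (density f)"
  have "ennreal \<rho> \<le> (SUP g\<in>N. lower_NSA_density A h g)"
  proof (rule ennreal_le_epsilon)
    fix e :: real assume e: "0 < e"
    obtain r0 where r0: "1 \<le> r0"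
      and good: "\<forall>R. \<exists>a. \<forall>r\<in>{r0..R}. (\<rho> - e) * (pi * r\<^sup>2) \<le> disc_integral (density f) a r"
      unfolding \<rho>_def by (rule f.good_centre[OF e])
    \<comment> \<open>These are closed conditions that grow stronger with \<open>n\<close>; a nested
      intersection replaces the choice of a cluster point. The index set always contains
      \<open>r0\<close>, so \<open>C n \<subseteq> N\<close>.\<close>
    define C where "C = (\<lambda>n::nat. \<Inter>r\<in>{r0..r0 + real n}.
      N \<inter> {g \<in> brody. disc_integral (density g) 0 r \<in> {(\<rho> - e) * (pi * r\<^sup>2)..}})"
    have "(\<Inter>n. C n) \<noteq> {}"
    proof (rule compact_space_imp_nest[OF compact_brody_space])
      show "closedin (brody_space X A h) (C n)" for n
        unfolding C_def
        by (intro closedin_INT closedin_Int N closedin_disc_integral closed_atLeast) (use r0 in auto)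
      show "C n \<noteq> {}" for n
      proof -
        obtain a where "\<forall>r\<in>{r0..r0 + real n}. (\<rho> - e) * (pi * r\<^sup>2) \<le> disc_integral (density f) a r"
          using good by blast
        moreover have "density (translate a f) = (\<lambda>z. density f (z + a))"
          using translate_brody(2)[OF fB] by blast
        ultimately have "translate a f \<in> C n"
          using f[of a] NB by (auto simp: C_def disc_integral_shift[OF f.measurable_u])
        then show ?thesis by blast
      qed
      show "decseq C"
        unfolding decseq_def C_def by (intro allI impI INF_superset_mono) auto
    qed
    then obtain g where g: "\<And>n. g \<in> C n" by blast
    have gN: "g \<in> N" using g[of 0] by (auto simp: C_def)
    have "(\<rho> - e) * (pi * r\<^sup>2) \<le> disc_integral (density g) 0 r" if "r0 \<le> r" for r
    proof -
      obtain n where "r - r0 \<le> real n" using real_arch_simple by blast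
      then show ?thesis using g[of n] that by (auto simp: C_def)
    qed
    then have "ennreal (\<rho> - e) \<le> lower_NSA_density A h g"
      using plane_density.Liminf_char_fun_ge[OF plane_density_brody r0, of g "\<rho> - e"] gN NB
      by (auto simp: lower_NSA_density_def NSA_characteristic_eq)
    also have "\<dots> \<le> (SUP g\<in>N. lower_NSA_density A h g)" using gN by (rule SUP_upper)
    finally have "ennreal (\<rho> - e) + ennreal e \<le> (SUP g\<in>N. lower_NSA_density A h g) + ennreal e"
      by (rule add_right_mono)
    \<comment> \<open>If \<open>e\<close> exceeds \<open>\<rho>\<close>, then
      \<open>ennreal (\<rho> - e)\<close> is 0 and the bound is just
      \<open>\<rho> \<le> e\<close>.\<close>
    moreover have "ennreal \<rho> \<le> ennreal (\<rho> - e) + ennreal e"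
      using e by (cases "e \<le> \<rho>") (auto simp: ennreal_neg ennreal_leI simp flip: ennreal_plus)
    ultimately show "ennreal \<rho> \<le> (SUP g\<in>N. lower_NSA_density A h g) + ennreal e"
      by (rule order.trans[rotated])
  qed
  then show ?thesis by (simp add: energy_density_eq[OF fB] \<rho>_def)
qed

lemma orbit_subset: "f \<in> brody \<Longrightarrow> range (\<lambda>a. translate a f) \<subseteq> brody"
  using translate_brody(1) by blast

lemma orbit_closure_closed: "closedin (brody_space X A h) (orbit_closure X A h f)"
  by (simp add: orbit_closure_def)

lemma orbit_subset_closure: "f \<in> brody \<Longrightarrow> translate a f \<in> orbit_closure X A h f"
  unfolding orbit_closure_def
  using closure_of_subset[of "range (\<lambda>a. translate a f)" "brody_space X A h"] orbit_subset topspace_brody_space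
  by blast

text \<open>For fixed \<open>a\<close> and \<open>r\<close>, the bound of the disc integral through
  \<open>mean_sup (density f) r\<close> is a closed condition satisfied by all translates of
  \<open>f\<close>, hence by the whole orbit closure.\<close>

lemma energy_density_orbit_closure_le:
  assumes f: "f \<in> brody" and g: "g \<in> orbit_closure X A h f"
  shows "energy_density A h g \<le> energy_density A h f"
proof -
  have gB: "g \<in> brody"
    using closedin_subset[OF orbit_closure_closed] g topspace_brody_space by blast
  interpret f: plane_density "density f" by (rule plane_density_brody[OF f])
  interpret g: plane_density "density g" by (rule plane_density_brody[OF gB])
  have "disc_density (density g) \<le> mean_sup (density f) r" if r: "0 < r" for r
  proof -
    have "disc_integral (density g) a r \<le> mean_sup (density f) r * (pi * r\<^sup>2)" for a
    proof -
      let ?C = "{k \<in> brody. disc_integral (density k) a r \<in> {..mean_sup (density f) r * (pi * r\<^sup>2)}}"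
      have "disc_integral (density (translate b f)) a r = disc_integral (density f) (a + b) r" for b
      proof -
        have "density (translate b f) = (\<lambda>z. density f (z + b))"
          using translate_brody(2)[OF f] by blast
        then show ?thesis
          using disc_integral_shift[of "\<lambda>z. density f (z + b)" a r] disc_integral_shift[of "density f" "a + b" r] f.measurable_u
          by (simp add: add.assoc)
      qed
      then have "range (\<lambda>a. translate a f) \<subseteq> ?C"
        using f.disc_integral_le_mean_sup[OF r] translate_brody(1)[OF f] by auto
      then have "orbit_closure X A h f \<subseteq> ?C"
        unfolding orbit_closure_def by (rule closure_of_minimal) (rule closedin_disc_integral[OF r closed_atMost])
      then show ?thesis using g by auto
    qed
    then have "mean_sup (density g) r \<le> mean_sup (density f) r"
      using r by (intro g.mean_sup_leI) auto
    then show ?thesis using g.disc_density_le[OF r] by simp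
  qed
  then have "disc_density (density g) \<le> disc_density (density f)"
    unfolding disc_density_def[of "density f"] by (intro cINF_greatest) auto
  then show ?thesis
    by (simp add: energy_density_eq f gB ennreal_leI)
qed

lemma SUP_NSA_density_le:
  assumes "N \<subseteq> brody"
  shows "(SUP f\<in>N. lower_NSA_density A h f) \<le> (SUP f\<in>N. upper_NSA_density A h f)"
    and "(SUP f\<in>N. upper_NSA_density A h f) \<le> (SUP f\<in>N. energy_density A h f)"
  using assms lower_NSA_density_le upper_NSA_density_le by (intro SUP_mono; blast)+

text \<open>Invariance puts every orbit inside \<open>N\<close>, so each energy density is at most
  the supremum of the lower densities; this closes the cycle of inequalities between the three
  suprema.\<close>

lemma SUP_densities_eq:
  assumes N: "closedin (brody_space X A h) N" "translation_invariant N"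
  shows "(SUP f\<in>N. energy_density A h f) = (SUP f\<in>N. upper_NSA_density A h f)"
    and "(SUP f\<in>N. upper_NSA_density A h f) = (SUP f\<in>N. lower_NSA_density A h f)"
proof -
  have NB: "N \<subseteq> brody" using closedin_subset[OF N(1)] topspace_brody_space by simp
  have "(SUP f\<in>N. energy_density A h f) \<le> (SUP f\<in>N. lower_NSA_density A h f)"
    using N(2) unfolding translation_invariant_def
    by (intro SUP_least energy_density_le_SUP_lower_NSA_density[OF N(1)]) auto
  with SUP_NSA_density_le[OF NB] show
    "(SUP f\<in>N. energy_density A h f) = (SUP f\<in>N. upper_NSA_density A h f)"
    "(SUP f\<in>N. upper_NSA_density A h f) = (SUP f\<in>N. lower_NSA_density A h f)" by auto
qed

text \<open>The same cycle, now passing through \<open>energy_density A h f\<close> itself, which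
  lies between the supremum of the energy densities and that of the lower densities on the
  closure.\<close>

lemma SUP_densities_orbit_closure:
  assumes f: "f \<in> brody"
  defines "Z \<equiv> orbit_closure X A h f"
  shows "energy_density A h f = (SUP g\<in>Z. energy_density A h g)"
    and "(SUP g\<in>Z. energy_density A h g) = (SUP g\<in>Z. upper_NSA_density A h g)"
    and "(SUP g\<in>Z. upper_NSA_density A h g) = (SUP g\<in>Z. lower_NSA_density A h g)"
proof -
  have "Z \<subseteq> brody"
    using closedin_subset[OF orbit_closure_closed] topspace_brody_space by (simp add: Z_def)
  note SUP_NSA_density_le[OF this]
  moreover have "energy_density A h f \<le> (SUP g\<in>Z. lower_NSA_density A h g)"
    unfolding Z_def
    by (intro energy_density_le_SUP_lower_NSA_density orbit_closure_closed orbit_subset_closure f)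
  moreover have "(SUP g\<in>Z. energy_density A h g) \<le> energy_density A h f"
    unfolding Z_def by (intro SUP_least energy_density_orbit_closure_le f)
  ultimately show "energy_density A h f = (SUP g\<in>Z. energy_density A h g)"
    "(SUP g\<in>Z. energy_density A h g) = (SUP g\<in>Z. upper_NSA_density A h g)"
    "(SUP g\<in>Z. upper_NSA_density A h g) = (SUP g\<in>Z. lower_NSA_density A h g)" by auto
qed

end

theorem theorem1p2:
  fixes X :: "'a topology"
    and A :: "('a, 'n::finite) chart set"
    and h :: "('a, 'n) chart \<Rightarrow> 'a \<Rightarrow> complex^'n^'n"
  assumes "compact_hermitian_manifold X A h"
  shows "(\<forall>f\<in>brody_curves X A h.
            energy_density A h f = (SUP g\<in>orbit_closure X A h f. energy_density A h g) \<and>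
            (SUP g\<in>orbit_closure X A h f. energy_density A h g)
              = (SUP g\<in>orbit_closure X A h f. upper_NSA_density A h g) \<and>
            (SUP g\<in>orbit_closure X A h f. upper_NSA_density A h g)
              = (SUP g\<in>orbit_closure X A h f. lower_NSA_density A h g)) \<and>
         (\<forall>N. closedin (brody_space X A h) N \<and> translation_invariant N \<longrightarrow>
            (SUP f\<in>N. energy_density A h f) = (SUP f\<in>N. upper_NSA_density A h f) \<and>
            (SUP f\<in>N. upper_NSA_density A h f) = (SUP f\<in>N. lower_NSA_density A h f))"
proof -
  interpret compact_hermitian_manifold X A h by fact
  show ?thesis
    using SUP_densities_orbit_closure SUP_densities_eq by blast
qed

end
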